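(* For any negative discriminant $-d\equiv\pm1\pmod5$, the polynomial $p_{9d}(x)$ divides the resultant $\mathrm{Res}_y\big(P_3(y,x),p_d(y)\big)$, where $P_3(u,v)=(v-u^3)(1+uv^3)-3u^2v^2$.
   Context: $r(\tau)=q^{1/5}\prod_{m\ge1}(1-q^m)^{\left(\frac{m}{5}\right)}$ ($q=e^{2\pi i\tau}$) is the Rogers–Ramanujan continued fraction. For a negative discriminant $-D=d_Kf^2$ with $\left(\frac{-D}{5}\right)=+1$ ($d_K$ the discriminant of $K=\mathbb{Q}(\sqrt{-D})$, $R_K$ its ring of integers, $\wp_5$ a prime ideal of $R_K$ dividing $5$), $p_D(x)$ denotes the minimal polynomial over $\mathbb{Q}$ of $r(w_D/5)$, where $w_D=\frac{v+\sqrt{-D}}{2}\in R_K$ ($v\in\mathbb{Z}$), $\wp_5^2\mid w_D$ and $\gcd(N(w_D),f)=1$; this polynomial depends only on $D$. *)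

theory Defs
  imports
    "HOL-Analysis.Infinite_Products"
    "HOL-Number_Theory.Residues"
    "HOL-Algebra.Ideal_Product"
    "Subresultants.Resultant_Prelim"
begin

text \<open>
  The Rogers--Ramanujan continued fraction on the upper half plane, where \<open>q\<^sup>1\<^sup>/\<^sup>5\<close> means
  \<open>exp (2 \<pi> \<i> \<tau> / 5)\<close>. The index \<open>m\<close> of the product starts at 0, so the factor is the one for
  \<open>m + 1\<close>.
\<close>

definition rr_cf :: "complex \<Rightarrow> complex" where
  "rr_cf \<tau> = exp (2 * of_real pi * \<i> * \<tau> / 5) *
     (\<Prod>m. (1 - exp (2 * of_real pi * \<i> * \<tau>) ^ Suc m) powi Legendre (int (Suc m)) 5)"

text \<open>
  The minimal polynomial over the rationals; as usual for a total version it is 0 on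
  transcendental numbers.
\<close>

definition min_poly_rat :: "complex \<Rightarrow> rat poly" where
  "min_poly_rat z =
     (if algebraic z then
        (THE p. lead_coeff p = 1 \<and> poly (map_poly of_rat p) z = 0 \<and>
           (\<forall>q. q \<noteq> 0 \<and> poly (map_poly of_rat q) z = 0 \<longrightarrow> degree p \<le> degree q))
      else 0)"

definition sqrt_neg :: "int \<Rightarrow> complex" where
  "sqrt_neg D = \<i> * of_real (sqrt (of_int D))"

definition quad_field :: "int \<Rightarrow> complex set" where
  "quad_field D = {of_rat a + of_rat b * sqrt_neg D | a b. True}"

definition quad_integers :: "int \<Rightarrow> complex ring" where
  "quad_integers D =
     \<lparr>carrier = {z \<in> quad_field D. algebraic_int z},
      mult = (*), one = 1, zero = 0, add = (+)\<rparr>"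

text \<open>
  \<open>\<Delta>\<close> is the discriminant of the imaginary quadratic field: the squared determinant of the matrix
  of conjugates of an integral basis \<open>\<alpha>, \<beta>\<close>.
\<close>

definition is_field_disc :: "int \<Rightarrow> int \<Rightarrow> bool" where
  "is_field_disc D \<Delta> \<longleftrightarrow>
     (\<exists>\<alpha> \<beta>. carrier (quad_integers D) = {of_int a * \<alpha> + of_int b * \<beta> | a b. True} \<and>
            of_int \<Delta> = (\<alpha> * cnj \<beta> - cnj \<alpha> * \<beta>)\<^sup>2)"

definition ideal_divides_elem :: "complex ring \<Rightarrow> complex set \<Rightarrow> complex \<Rightarrow> bool" where
  "ideal_divides_elem R I x \<longleftrightarrow> (\<exists>J. ideal J R \<and> PIdl\<^bsub>R\<^esub> x = I \<cdot>\<^bsub>R\<^esub> J)"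

definition negative_discriminant :: "int \<Rightarrow> bool" where
  "negative_discriminant \<Delta> \<longleftrightarrow> \<Delta> < 0 \<and> ([\<Delta> = 0] (mod 4) \<or> [\<Delta> = 1] (mod 4))"

text \<open>The numbers \<open>w\<close> that may serve as \<open>w\<^sub>D\<close>; the norm of \<open>w\<close> is \<open>n = w * cnj w\<close>.\<close>

definition is_w :: "int \<Rightarrow> complex \<Rightarrow> bool" where
  "is_w D w \<longleftrightarrow>
     (\<exists>dK f v n P.
        is_field_disc D dK \<and> f > 0 \<and> - D = dK * f\<^sup>2 \<and>
        w = (of_int v + sqrt_neg D) / 2 \<and> w \<in> carrier (quad_integers D) \<and>
        primeideal P (quad_integers D) \<and>
        ideal_divides_elem (quad_integers D) P 5 \<and>
        ideal_divides_elem (quad_integers D) (P \<cdot>\<^bsub>quad_integers D\<^esub> P) w \<and>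
        of_int n = w * cnj w \<and> coprime n f)"

text \<open>
  \<open>p\<close> is the polynomial \<open>p\<^sub>D\<close>, computed from some admissible \<open>w\<^sub>D\<close>. The polynomial does not depend
  on the choice of \<open>w\<^sub>D\<close>; a statement about all \<open>p\<close> with \<open>is_p D p\<close> covers every choice.
\<close>

definition is_p :: "int \<Rightarrow> rat poly \<Rightarrow> bool" where
  "is_p D p \<longleftrightarrow> (\<exists>w. is_w D w \<and> p = min_poly_rat (rr_cf (w / 5)))"

definition P3 :: "'a :: comm_ring_1 \<Rightarrow> 'a \<Rightarrow> 'a" where
  "P3 u v = (v - u ^ 3) * (1 + u * v ^ 3) - 3 * u\<^sup>2 * v\<^sup>2"

text \<open>
  Bivariate polynomials are polynomials in \<open>y\<close> whose coefficients are polynomials in \<open>x\<close>: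
  \<open>y = [:0, 1:]\<close> and \<open>x = [:[:0, 1:]:]\<close>, and \<open>p(y)\<close> has constant coefficients.
\<close>

definition res_P3 :: "rat poly \<Rightarrow> rat poly" where
  "res_P3 p = resultant (P3 [:0, 1:] [:[:0, 1:]:]) (map_poly (\<lambda>c. [:c:]) p)"

end

theory Submission
  imports
    Defs
    "HOL-Analysis.Analysis"
    "HOL-Real_Asymp.Real_Asymp"
    "HOL-Computational_Algebra.Field_as_Ring"
    "Subresultants.Subresultant_Gcd"
begin

text \<open>
  Write \<open>w\<^sub>d = (v + \<surd>(-d)) / 2\<close> and \<open>w\<^sub>9\<^sub>d = (v' + 3 \<surd>(-d)) / 2\<close>. Divisibility by the square of a prime
  above 5 forces \<open>25\<close> to divide both norms, hence \<open>v' \<equiv> \<plusminus> 3 v (mod 50)\<close>. Because \<open>r(\<tau> + 5) = r(\<tau>)\<close> and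
  \<open>r(- cnj \<tau>) = cnj r(\<tau>)\<close>, the number \<open>r(w\<^sub>9\<^sub>d / 5)\<close> is \<open>r(3 \<tau>)\<close> or its conjugate, where \<open>\<tau> = w\<^sub>d / 5\<close>;
  so the theorem reduces to the cubic modular equation \<open>P\<^sub>3(r(\<tau>), r(3 \<tau>)) = 0\<close>.

  With \<open>\<theta>(x; p) = \<Prod>(1 - x p\<^sup>n)(1 - p\<^sup>n\<^sup>+\<^sup>1 / x)\<close>, we have \<open>r(\<tau>) = q\<^sup>1\<^sup>/\<^sup>5 \<theta>(q; q\<^sup>5) / \<theta>(q\<^sup>2; q\<^sup>5)\<close>. Weierstrass's
  three-term relation gives a formula for
  \<open>\<theta>(zt) \<theta>(z/t) \<theta>(z\<^sup>2)\<^sup>2 - \<theta>(z)\<^sup>2 \<theta>(z\<^sup>2t) \<theta>(z\<^sup>2/t)\<close>. It is used twice with \<open>t\<close> a 3-torsion point: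
  for \<open>z = q\<close>, \<open>p = q\<^sup>5\<close> and \<open>t\<close> a cube root of unity, and for \<open>z = q\<^sup>3\<close>, \<open>p = q\<^sup>1\<^sup>5\<close> and \<open>t = q\<^sup>5\<close>. The
  product of the two resulting identities is the modular equation.
\<close>

subsection \<open>Theta products\<close>

text \<open>The infinite q-shifted factorial of \<open>a\<close> with nome \<open>p\<close>.\<close>

definition qpoch :: "complex \<Rightarrow> complex \<Rightarrow> complex" where
  "qpoch a p = (\<Prod>n. 1 - a * p ^ n)"

lemma convergent_prod_qpoch:
  fixes a p :: complex
  assumes "norm p < 1"
  shows "convergent_prod (\<lambda>n. 1 - a * p ^ n)"
proof -
  have "summable (\<lambda>n. norm a * norm p ^ n)"
    using assms by (intro summable_mult summable_geometric) auto
  then have "summable (\<lambda>n. norm ((1 - a * p ^ n) - 1))"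
    by (simp add: norm_mult norm_power)
  then show ?thesis
    by (blast intro: abs_convergent_prod_imp_convergent_prod summable_imp_abs_convergent_prod)
qed

text \<open>Partial products over \<open>n < N\<close> have exactly \<open>N\<close> factors, which
  suits the later grouping into blocks of equal length.\<close>

lemma convergent_prod_lessThan_LIMSEQ:
  fixes f :: "nat \<Rightarrow> complex"
  assumes "convergent_prod f"
  shows "(\<lambda>N. \<Prod>n<N. f n) \<longlonglongrightarrow> prodinf f"
proof -
  have "(\<lambda>N. \<Prod>n<Suc N. f n) \<longlonglongrightarrow> prodinf f"
    using convergent_prod_LIMSEQ[OF assms] by (simp only: lessThan_Suc_atMost)
  then show ?thesis
    by (rule filterlim_sequentially_Suc[THEN iffD1])
qed

lemma qpoch_LIMSEQ: "norm p < 1 \<Longrightarrow> (\<lambda>N. \<Prod>n<N. 1 - a * p ^ n) \<longlonglongrightarrow> qpoch a p"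
  unfolding qpoch_def by (intro convergent_prod_lessThan_LIMSEQ convergent_prod_qpoch)

text \<open>\<open>has_prod\<close> allows finitely many zero factors and asks for a nonzero limit
  of the rest, so the value is 0 precisely when a factor is.\<close>

lemma qpoch_eq_0_iff:
  assumes "norm p < 1"
  shows "qpoch a p = 0 \<longleftrightarrow> (\<exists>n. a * p ^ n = 1)"
proof -
  have "(\<lambda>n. 1 - a * p ^ n) has_prod qpoch a p"
    unfolding qpoch_def using convergent_prod_qpoch[OF assms] by blast
  from has_prod_eq_0_iff[OF this] show ?thesis
    by (auto simp: eq_commute[of 1])
qed

lemma qpoch_nonzero:
  assumes "norm p < 1" "norm a < 1"
  shows "qpoch a p \<noteq> 0"
proof
  assume "qpoch a p = 0"
  then obtain n where "a * p ^ n = 1"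
    using qpoch_eq_0_iff assms by auto
  then have "norm a * norm p ^ n = 1"
    by (metis norm_mult norm_one norm_power)
  moreover have "norm a * norm p ^ n \<le> norm a * 1"
    using assms by (intro mult_left_mono power_le_one) auto
  ultimately show False
    using assms by simp
qed

lemma qpoch_rec:
  assumes "norm p < 1"
  shows "qpoch a p = (1 - a) * qpoch (a * p) p"
proof (rule LIMSEQ_unique)
  show "(\<lambda>N. \<Prod>n<Suc N. 1 - a * p ^ n) \<longlonglongrightarrow> qpoch a p"
    using qpoch_LIMSEQ[OF assms] by (rule filterlim_sequentially_Suc[THEN iffD2])
  have "(\<lambda>N. (1 - a) * (\<Prod>n<N. 1 - (a * p) * p ^ n)) \<longlonglongrightarrow> (1 - a) * qpoch (a * p) p"
    using qpoch_LIMSEQ[OF assms] by (intro tendsto_intros)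
  then show "(\<lambda>N. \<Prod>n<Suc N. 1 - a * p ^ n) \<longlonglongrightarrow> (1 - a) * qpoch (a * p) p"
    by (simp only: prod.lessThan_Suc_shift) (simp add: mult.assoc)
qed

text \<open>The factors are sorted by their exponent modulo \<open>k\<close>. Since the whole
  sequence of partial products converges, its limit may be taken along the lengths
  \<open>N * k\<close>.\<close>

lemma qpoch_dissect:
  assumes "norm p < 1" "k > 0"
  shows "qpoch a p = (\<Prod>i<k. qpoch (a * p ^ i) (p ^ k))"
proof (rule LIMSEQ_unique)
  have "filterlim (\<lambda>N. N * k) at_top sequentially"
    using assms by (intro mult_nat_right_at_top)
  from filterlim_compose[OF qpoch_LIMSEQ[OF assms(1)] this]
  show "(\<lambda>N. \<Prod>n<N * k. 1 - a * p ^ n) \<longlonglongrightarrow> qpoch a p" .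
  have k: "norm (p ^ k) < 1"
    using assms by (simp add: norm_power power_less_one_iff)
  have "(\<lambda>N. \<Prod>i<k. \<Prod>n<N. 1 - (a * p ^ i) * (p ^ k) ^ n) \<longlonglongrightarrow> (\<Prod>i<k. qpoch (a * p ^ i) (p ^ k))"
    by (intro tendsto_prod qpoch_LIMSEQ k)
  also have "(\<lambda>N. \<Prod>i<k. \<Prod>n<N. 1 - (a * p ^ i) * (p ^ k) ^ n) = (\<lambda>N. \<Prod>n<N * k. 1 - a * p ^ n)"
  proof
    fix N
    have "(\<Prod>n<N * k. 1 - a * p ^ n) = (\<Prod>m<N. \<Prod>n\<in>{m*k..<m*k+k}. 1 - a * p ^ n)"
      by (rule prod.nat_group[symmetric])
    also have "\<dots> = (\<Prod>m<N. \<Prod>i<k. 1 - a * p ^ (m * k + i))"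
    proof (rule prod.cong[OF refl])
      fix m
      show "(\<Prod>n = m * k..<m * k + k. 1 - a * p ^ n) = (\<Prod>i<k. 1 - a * p ^ (m * k + i))"
        by (rule prod.reindex_bij_witness[of _ "\<lambda>i. m * k + i" "\<lambda>i. i - m * k"]) auto
    qed
    also have "\<dots> = (\<Prod>m<N. \<Prod>i<k. 1 - (a * p ^ i) * (p ^ k) ^ m)"
      by (simp add: power_add power_mult[symmetric] mult_ac)
    also have "\<dots> = (\<Prod>i<k. \<Prod>n<N. 1 - (a * p ^ i) * (p ^ k) ^ n)"
      by (rule prod.swap)
    finally show "(\<Prod>i<k. \<Prod>n<N. 1 - (a * p ^ i) * (p ^ k) ^ n) = (\<Prod>n<N * k. 1 - a * p ^ n)" ..
  qed
  finally show "(\<lambda>N. \<Prod>n<N * k. 1 - a * p ^ n) \<longlonglongrightarrow> (\<Prod>i<k. qpoch (a * p ^ i) (p ^ k))" .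
qed

lemma one_minus_cube:
  fixes w a :: complex
  assumes "w\<^sup>2 + w + 1 = 0"
  shows "(1 - a) * (1 - w * a) * (1 - w\<^sup>2 * a) = 1 - a ^ 3"
  using assms by Groebner_Basis.algebra

lemma qpoch_cube:
  assumes "norm p < 1" "w\<^sup>2 + w + 1 = 0"
  shows "qpoch a p * qpoch (w * a) p * qpoch (w\<^sup>2 * a) p = qpoch (a ^ 3) (p ^ 3)"
proof (rule LIMSEQ_unique)
  show "(\<lambda>N. (\<Prod>n<N. 1 - a * p ^ n) * (\<Prod>n<N. 1 - w * a * p ^ n) * (\<Prod>n<N. 1 - w\<^sup>2 * a * p ^ n))
      \<longlonglongrightarrow> qpoch a p * qpoch (w * a) p * qpoch (w\<^sup>2 * a) p"
    using assms(1) by (intro tendsto_mult qpoch_LIMSEQ)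
  have "norm (p ^ 3) < 1"
    using assms(1) by (simp add: norm_power power_less_one_iff)
  moreover have "(1 - a * p ^ n) * (1 - w * a * p ^ n) * (1 - w\<^sup>2 * a * p ^ n) = 1 - a ^ 3 * (p ^ 3) ^ n" for n
    using one_minus_cube[OF assms(2), of "a * p ^ n"]
    by (simp add: mult.assoc power_mult_distrib power_mult[symmetric] mult.commute[of n])
  ultimately show "(\<lambda>N. (\<Prod>n<N. 1 - a * p ^ n) * (\<Prod>n<N. 1 - w * a * p ^ n) * (\<Prod>n<N. 1 - w\<^sup>2 * a * p ^ n))
      \<longlonglongrightarrow> qpoch (a ^ 3) (p ^ 3)"
    using qpoch_LIMSEQ[of "p ^ 3" "a ^ 3"] by (simp add: prod.distrib[symmetric])
qed

text \<open>The modified theta function, written \<theta>(x; p) in the overview.\<close>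

definition qtheta :: "complex \<Rightarrow> complex \<Rightarrow> complex" where
  "qtheta x p = qpoch x p * qpoch (p / x) p"

lemma qtheta_reflect: "p \<noteq> 0 \<Longrightarrow> x \<noteq> 0 \<Longrightarrow> qtheta (p / x) p = qtheta x p"
  by (simp add: qtheta_def)

text \<open>Both sides contain the same shifted products; only the factor \<open>1 - 1 / x\<close>
  has to be traded for \<open>1 - x\<close>, which costs \<open>- 1 / x\<close>.\<close>

lemma qtheta_inverse:
  assumes "norm p < 1" "x \<noteq> 0"
  shows "qtheta (1 / x) p = - qtheta x p / x"
proof -
  have "qtheta (1 / x) p = (1 - 1 / x) * qpoch (p / x) p * qpoch (x * p) p"
    using assms qpoch_rec[of p "1 / x"] by (simp add: qtheta_def mult.commute)
  also have "\<dots> = - ((1 - x) * qpoch (x * p) p * qpoch (p / x) p) / x"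
    using assms by (simp add: divide_simps) (simp add: algebra_simps)
  finally show ?thesis
    using assms qpoch_rec[of p x] by (simp add: qtheta_def)
qed

lemma qtheta_cube:
  assumes "norm p < 1" "w\<^sup>2 + w + 1 = 0" "x \<noteq> 0"
  shows "qtheta x p * qtheta (x * w) p * qtheta (x / w) p = qtheta (x ^ 3) (p ^ 3)"
proof -
  have w: "w \<noteq> 0" "1 / w = w\<^sup>2"
  proof -
    show "w \<noteq> 0"
      using assms(2) by auto
    moreover have "w * w\<^sup>2 = 1"
      using assms(2) by Groebner_Basis.algebra
    ultimately show "1 / w = w\<^sup>2"
      by (simp add: field_simps)
  qed
  have "qtheta (x * w) p = qpoch (w * x) p * qpoch (w\<^sup>2 * (p / x)) p"
    "qtheta (x / w) p = qpoch (w\<^sup>2 * x) p * qpoch (w * (p / x)) p"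
    by (simp_all add: qtheta_def mult.commute flip: w(2))
  then have "qtheta x p * qtheta (x * w) p * qtheta (x / w) p =
      (qpoch x p * qpoch (w * x) p * qpoch (w\<^sup>2 * x) p) *
      (qpoch (p / x) p * qpoch (w * (p / x)) p * qpoch (w\<^sup>2 * (p / x)) p)"
    by (simp only: qtheta_def mult_ac)
  also have "\<dots> = qtheta (x ^ 3) (p ^ 3)"
    unfolding qpoch_cube[OF assms(1,2)] by (simp add: qtheta_def power_divide)
  finally show ?thesis .
qed

text \<open>Both halves of the theta product are dissected. The pieces of the second half match
  those of the first in reverse order, because
  \<open>p / x * p ^ i = p ^ 3 / (x * p ^ (2 - i))\<close>.\<close>

lemma qtheta_dissect3:
  assumes "norm p < 1" "x \<noteq> 0" "p \<noteq> 0"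
  shows "qtheta x p = qtheta x (p ^ 3) * qtheta (x * p) (p ^ 3) * qtheta (x * p\<^sup>2) (p ^ 3)"
  using assms qpoch_dissect[of p 3 x] qpoch_dissect[of p 3 "p / x"]
  by (simp add: qtheta_def lessThan_Suc eval_nat_numeral)

lemma qtheta_nonzero:
  assumes "norm p < norm x" "norm x < 1"
  shows "qtheta x p \<noteq> 0"
proof -
  have "x \<noteq> 0" "norm p < 1"
    using assms by (auto simp: not_less intro: order_trans)
  then show ?thesis
    using assms qpoch_nonzero[of p x] qpoch_nonzero[of p "p / x"]
    by (simp add: qtheta_def norm_divide)
qed

text \<open>Up to \<open>1 - w\<close>, the first factor is
  \<open>qpoch (p ^ 3) (p ^ 3) / qpoch p p\<close> by the cube formula, and the second is the
  inverse quotient by dissection. This evaluates the constant of the modular equation.\<close>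

lemma qtheta_root_of_unity:
  assumes "norm p < 1" "w\<^sup>2 + w + 1 = 0" "p \<noteq> 0"
  shows "qtheta w p * qtheta p (p ^ 3) = 1 - w"
proof -
  have w: "w \<noteq> 0" "p / w = w\<^sup>2 * p"
  proof -
    show "w \<noteq> 0"
      using assms(2) by auto
    moreover have "w * w\<^sup>2 = 1"
      using assms(2) by Groebner_Basis.algebra
    ultimately show "p / w = w\<^sup>2 * p"
      by (simp add: field_simps)
  qed
  have p3: "norm (p ^ 3) < 1"
    using assms(1) by (simp add: norm_power power_less_one_iff)
  have "qpoch p p = qpoch p (p ^ 3) * qpoch (p\<^sup>2) (p ^ 3) * qpoch (p ^ 3) (p ^ 3)"
    using qpoch_dissect[OF assms(1), of 3 p] by (simp add: lessThan_Suc eval_nat_numeral mult_ac)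
  moreover have "qpoch p p * qpoch (w * p) p * qpoch (w\<^sup>2 * p) p = qpoch (p ^ 3) (p ^ 3)"
    by (rule qpoch_cube[OF assms(1,2)])
  moreover have "qpoch (p ^ 3) (p ^ 3) \<noteq> 0"
    using p3 by (intro qpoch_nonzero)
  ultimately have *: "qpoch (w * p) p * qpoch (w\<^sup>2 * p) p * (qpoch p (p ^ 3) * qpoch (p\<^sup>2) (p ^ 3)) = 1"
    by (simp add: field_simps)
  have "qtheta w p = (1 - w) * (qpoch (w * p) p * qpoch (w\<^sup>2 * p) p)"
    by (simp add: qtheta_def w qpoch_rec[OF assms(1), of w])
  moreover have "qtheta p (p ^ 3) = qpoch p (p ^ 3) * qpoch (p\<^sup>2) (p ^ 3)"
    using assms(3) by (simp add: qtheta_def eval_nat_numeral)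
  ultimately show ?thesis
    using * by (simp add: mult_ac)
qed

subsection \<open>The Jacobi triple product\<close>

definition qfact :: "complex \<Rightarrow> nat \<Rightarrow> complex" where
  "qfact p n = (\<Prod>i<n. 1 - p ^ Suc i)"

text \<open>The Gaussian binomial coefficient. The value 0 for \<open>k > n\<close> covers the
  boundary term of the Pascal rule.\<close>

definition qbinom :: "complex \<Rightarrow> nat \<Rightarrow> nat \<Rightarrow> complex" where
  "qbinom p n k = (if k \<le> n then qfact p n / (qfact p k * qfact p (n - k)) else 0)"

lemma qfact_nonzero:
  assumes "norm p < 1"
  shows "qfact p n \<noteq> 0"
proof -
  have "p ^ Suc i \<noteq> 1" for i
  proof
    assume "p ^ Suc i = 1"
    then have "norm p ^ Suc i = 1"
      by (metis norm_one norm_power)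
    then show False
      using assms power_less_one_iff[of "norm p" "Suc i"] by simp
  qed
  then show ?thesis
    by (simp add: qfact_def)
qed

lemma qfact_Suc: "qfact p (Suc n) = qfact p n * (1 - p ^ Suc n)"
  by (simp add: qfact_def)

lemma qfact_LIMSEQ: "norm p < 1 \<Longrightarrow> qfact p \<longlonglongrightarrow> qpoch p p"
  using qpoch_LIMSEQ[of p p] by (simp add: qfact_def[abs_def])

text \<open>Of the two q-Pascal rules, this is the one that matches splitting the last factor
  \<open>1 + z * p ^ n\<close> off the product in the q-binomial theorem.\<close>

lemma qbinom_Suc_Suc:
  assumes "norm p < 1" "k \<le> n"
  shows "qbinom p (Suc n) (Suc k) = qbinom p n (Suc k) + p ^ (n - k) * qbinom p n k"
proof (cases "k = n")
  case True
  then show ?thesis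
    using qfact_nonzero[OF assms(1)] by (simp add: qbinom_def)
next
  case False
  define m where "m = n - Suc k"
  have n: "n = k + Suc m"
    using False assms by (simp add: m_def)
  have "qfact p k \<noteq> 0" "qfact p m \<noteq> 0" "1 - p ^ Suc k \<noteq> 0" "1 - p ^ Suc m \<noteq> 0"
    using qfact_nonzero[OF assms(1), of "Suc k"] qfact_nonzero[OF assms(1), of "Suc m"]
    unfolding qfact_Suc by auto
  \<comment> \<open>The rule reduces to \<open>1 - a * b = (1 - b) + b * (1 - a)\<close> with
    \<open>a = p ^ Suc k\<close> and \<open>b = p ^ Suc m\<close>.\<close>
  moreover have "N * (1 - a * b) / (K * (1 - a) * (M * (1 - b))) = N / (K * (1 - a) * M) + b * (N / (K * (M * (1 - b))))"
    if "K \<noteq> 0" "M \<noteq> 0" "1 - a \<noteq> 0" "1 - b \<noteq> 0" for N K M a b :: complex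
  proof -
    have "N / (K * x * M) = N * y / (K * x * (M * y))" "b * (N / (K * (M * y))) = N * (b * x) / (K * x * (M * y))"
      if "x \<noteq> 0" "y \<noteq> 0" for x y
      using that by simp_all
    note this[OF that(3,4)]
    then show ?thesis
      by (simp only: add_divide_distrib[symmetric] distrib_left[symmetric]) (simp add: algebra_simps)
  qed
  ultimately have "qfact p n * (1 - p ^ Suc k * p ^ Suc m) / (qfact p (Suc k) * qfact p (Suc m)) =
      qfact p n / (qfact p (Suc k) * qfact p m) + p ^ Suc m * (qfact p n / (qfact p k * qfact p (Suc m)))"
    by (simp only: qfact_Suc)
  moreover have "p ^ Suc n = p ^ Suc k * p ^ Suc m"
    by (simp add: n power_add)
  moreover have "Suc n - Suc k = Suc m" "n - Suc k = m" "n - k = Suc m" "Suc k \<le> Suc n" "Suc k \<le> n" "k \<le> n"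
    by (simp_all add: n)
  ultimately show ?thesis
    by (simp only: qbinom_def qfact_Suc[of p n] if_True)
qed

lemma qbinom_0: "norm p < 1 \<Longrightarrow> qbinom p n 0 = 1"
  using qfact_nonzero[of p n] by (simp add: qbinom_def) (simp add: qfact_def)

lemma q_binomial_theorem:
  assumes "norm p < 1"
  shows "(\<Prod>k<n. 1 + z * p ^ k) = (\<Sum>k\<le>n. qbinom p n k * p ^ (k choose 2) * z ^ k)"
proof (induction n)
  case 0
  show ?case
    by (simp add: qbinom_def qfact_def binomial_eq_0)
next
  case (Suc n)
  let ?f = "\<lambda>n k. qbinom p n k * p ^ (k choose 2) * z ^ k"
  have step: "?f (Suc n) (Suc k) = ?f n (Suc k) + z * p ^ n * ?f n k" if "k \<le> n" for k
  proof -
    have "p ^ n = p ^ (n - k) * p ^ k"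
      using that by (simp flip: power_add)
    moreover have "Suc k choose 2 = k + (k choose 2)"
      by (simp add: numeral_2_eq_2)
    ultimately show ?thesis
      by (simp add: qbinom_Suc_Suc[OF assms that] algebra_simps power_add)
  qed
  have "(\<Sum>k\<le>Suc n. ?f (Suc n) k) = 1 + (\<Sum>k\<le>n. ?f (Suc n) (Suc k))"
    by (subst sum.atMost_Suc_shift) (simp add: qbinom_0 assms binomial_eq_0)
  also have "\<dots> = (1 + (\<Sum>k\<le>n. ?f n (Suc k))) + z * p ^ n * (\<Sum>k\<le>n. ?f n k)"
    by (simp add: step sum.distrib sum_distrib_left del: power_Suc)
  also have "1 + (\<Sum>k\<le>n. ?f n (Suc k)) = (\<Sum>k\<le>Suc n. ?f n k)"
    by (subst sum.atMost_Suc_shift) (simp add: qbinom_0 assms binomial_eq_0)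
  also have "\<dots> = (\<Sum>k\<le>n. ?f n k)"
    by (simp add: qbinom_def)
  finally show ?case
    by (simp add: Suc.IH algebra_simps)
qed

section \<open>Triangular exponents and the finite triple product\<close>

definition tri :: "int \<Rightarrow> nat" where
  "tri k = nat (k * (k - 1) div 2)"

text \<open>\<open>k * (k - 1)\<close> is even and nonnegative for every integer \<open>k\<close>,
  so neither \<open>div\<close> nor \<open>nat\<close> loses anything. Identities between values of
  \<open>tri\<close> thus become polynomial identities over the integers.\<close>

lemma int_tri: "2 * int (tri k) = k * (k - 1)"
proof -
  have "even (k * (k - 1))"
    by simp
  moreover have "k * (k - 1) \<ge> 0"
    by (cases "k \<ge> 1") (auto intro: mult_nonneg_nonneg mult_nonpos_nonpos)
  ultimately show ?thesis
    unfolding tri_def by (simp add: pos_imp_zdiv_nonneg_iff)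
qed

lemma tri_of_nat: "m choose 2 = tri (int m)"
proof (induction m)
  case 0
  show ?case by (simp add: tri_def binomial_eq_0)
next
  case (Suc m)
  have "Suc m choose 2 = m + (m choose 2)"
    by (simp add: numeral_2_eq_2)
  moreover have "tri (int (Suc m)) = m + tri (int m)"
    using int_tri[of "int (Suc m)"] int_tri[of "int m"] by (simp add: algebra_simps)
  ultimately show ?case
    using Suc.IH by simp
qed

lemma prod_powers: "(\<Prod>i<n. p ^ Suc i) = (p :: complex) ^ tri (int n + 1)"
proof (induction n)
  case 0
  then show ?case by (simp add: tri_def)
next
  case (Suc n)
  have "tri (int (Suc n) + 1) = tri (int n + 1) + Suc n"
    using int_tri[of "int (Suc n) + 1"] int_tri[of "int n + 1"] by (simp add: algebra_simps)
  then show ?case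
    by (simp only: prod.lessThan_Suc Suc.IH power_add)
qed

lemma prod_lessThan_add: "(\<Prod>k<m + n. f k) = (\<Prod>k<m. f k) * (\<Prod>k<n. f (m + k))"
  for f :: "nat \<Rightarrow> 'a :: comm_monoid_mult"
  by (induction n) (simp_all add: mult_ac)

text \<open>The q-binomial theorem for \<open>2 * n\<close> factors at \<open>- x / p ^ n\<close>,
  recentred: the upper \<open>n\<close> factors are the \<open>1 - x * p ^ i\<close>, the lower
  ones, read backwards, are the \<open>1 - p / x * p ^ i\<close> up to a monomial, and the summation
  index is shifted by \<open>n\<close>.\<close>

lemma finite_triple_product:
  assumes p: "norm p < 1" "p \<noteq> 0" and x: "x \<noteq> 0"
  shows "(\<Prod>i<n. 1 - x * p ^ i) * (\<Prod>i<n. 1 - p / x * p ^ i) =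
    (\<Sum>k\<in>{-int n..int n}. qbinom p (2 * n) (nat (int n + k)) * (p ^ tri k * (- x) powi k))"
proof -
  \<comment> \<open>The inverse of the monomial obtained by pulling \<open>- x / p ^ Suc i\<close>
    out of each of the lower \<open>n\<close> factors.\<close>
  let ?c = "p ^ tri (int n + 1) / (- x) ^ n"
  have "(\<Prod>k<2*n. 1 + (- x / p ^ n) * p ^ k) =
      (\<Prod>k<n. 1 + (- x / p ^ n) * p ^ k) * (\<Prod>k<n. 1 + (- x / p ^ n) * p ^ (n + k))"
    unfolding mult_2 by (rule prod_lessThan_add)
  also have "(\<Prod>k<n. 1 + (- x / p ^ n) * p ^ (n + k)) = (\<Prod>i<n. 1 - x * p ^ i)"
    using p by (simp add: power_add)
  also have "(\<Prod>k<n. 1 + (- x / p ^ n) * p ^ k) = (\<Prod>i<n. 1 + (- x / p ^ n) * p ^ (n - Suc i))"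
    by (rule prod.nat_diff_reindex[symmetric])
  also have "\<dots> = (\<Prod>i<n. (- x / p ^ Suc i) * (1 - p / x * p ^ i))"
  proof (rule prod.cong[OF refl])
    fix i assume "i \<in> {..<n}"
    then have "p ^ n = p ^ (n - Suc i) * p ^ Suc i"
      by (simp flip: power_add del: power_Suc)
    then show "1 + (- x / p ^ n) * p ^ (n - Suc i) = (- x / p ^ Suc i) * (1 - p / x * p ^ i)"
      using p x by (simp add: field_simps)
  qed
  also have "\<dots> = (- x) ^ n / p ^ tri (int n + 1) * (\<Prod>i<n. 1 - p / x * p ^ i)"
    by (simp only: prod.distrib prod_dividef prod_powers prod_constant card_lessThan)
  finally have *: "(\<Prod>k<2*n. 1 + (- x / p ^ n) * p ^ k) =
      (- x) ^ n / p ^ tri (int n + 1) * (\<Prod>i<n. 1 - p / x * p ^ i) * (\<Prod>i<n. 1 - x * p ^ i)" .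
  have "(\<Prod>i<n. 1 - x * p ^ i) * (\<Prod>i<n. 1 - p / x * p ^ i) =
      ?c * (\<Prod>k<2*n. 1 + (- x / p ^ n) * p ^ k)"
    unfolding * using p x by simp
  also have "\<dots> = (\<Sum>m\<le>2*n. ?c * (qbinom p (2 * n) m * p ^ (m choose 2) * (- x / p ^ n) ^ m))"
    unfolding q_binomial_theorem[OF p(1)] by (rule sum_distrib_left)
  also have "\<dots> = (\<Sum>k\<in>{-int n..int n}. qbinom p (2 * n) (nat (int n + k)) * (p ^ tri k * (- x) powi k))"
  proof (rule sum.reindex_bij_witness[of _ "\<lambda>k. nat (int n + k)" "\<lambda>m. int m - int n"])
    fix m assume "m \<in> {..2 * n}"
    have "int (tri (int n + 1) + (m choose 2)) = int (tri (int m - int n) + n * m)"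
      using int_tri[of "int n + 1"] int_tri[of "int m"] int_tri[of "int m - int n"]
      by (simp add: tri_of_nat algebra_simps)
    then have "tri (int n + 1) + (m choose 2) = tri (int m - int n) + n * m"
      by (simp only: of_nat_eq_iff)
    then have "p ^ tri (int n + 1) * p ^ (m choose 2) = p ^ tri (int m - int n) * (p ^ n) ^ m"
      by (metis power_add power_mult)
    then have "p ^ tri (int m - int n) = p ^ tri (int n + 1) * p ^ (m choose 2) / (p ^ n) ^ m"
      using p by simp
    moreover have "(- x) powi (int m - int n) = (- x) ^ m / (- x) ^ n"
      using x by (simp add: power_int_diff)
    moreover have "(- x / p ^ n) ^ m = (- x) ^ m / (p ^ n) ^ m"
      by (rule power_divide)
    ultimately show "qbinom p (2 * n) (nat (int n + (int m - int n))) *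
        (p ^ tri (int m - int n) * (- x) powi (int m - int n)) =
        ?c * (qbinom p (2 * n) m * p ^ (m choose 2) * (- x / p ^ n) ^ m)"
      by (simp add: mult_ac)
  qed auto
  finally show ?thesis .
qed

section \<open>The bilateral theta series and the passage to the limit\<close>

lemma summable_theta_terms:
  fixes p z :: complex
  assumes "norm p < 1"
  shows "summable (\<lambda>n. norm (p ^ tri (int n) * z ^ n))"
proof -
  \<comment> \<open>This is the ratio of the norms of consecutive terms; it tends to 0 for every
    \<open>z\<close>.\<close>
  have "(\<lambda>n. norm p ^ n * norm z) \<longlonglongrightarrow> 0 * norm z"
    using assms by (intro tendsto_mult LIMSEQ_power_zero tendsto_const) auto
  then have "eventually (\<lambda>n. norm p ^ n * norm z < 1 / 2) sequentially"
    by (intro order_tendstoD(2)[of _ 0]) auto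
  then obtain N where N: "\<And>n. n \<ge> N \<Longrightarrow> norm p ^ n * norm z < 1 / 2"
    by (auto simp: eventually_sequentially)
  show ?thesis
  proof (rule summable_ratio_test[of "1 / 2" N])
    fix n assume "n \<ge> N"
    have "tri (int (Suc n)) = n + tri (int n)"
      using int_tri[of "int (Suc n)"] int_tri[of "int n"] by (simp add: algebra_simps)
    then have "norm (p ^ tri (int (Suc n)) * z ^ Suc n) =
        (norm p ^ n * norm z) * norm (p ^ tri (int n) * z ^ n)"
      by (simp add: norm_mult norm_power power_add)
    also have "\<dots> \<le> 1 / 2 * norm (p ^ tri (int n) * z ^ n)"
      using N[OF \<open>n \<ge> N\<close>] by (intro mult_right_mono) auto
    finally show "norm (norm (p ^ tri (int (Suc n)) * z ^ Suc n)) \<le>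
        1 / 2 * norm (norm (p ^ tri (int n) * z ^ n))"
      by simp
  qed simp
qed

definition theta_series :: "complex \<Rightarrow> complex \<Rightarrow> complex" where
  "theta_series p z = (\<Sum>\<^sub>\<infinity>k. p ^ tri k * z powi k)"

text \<open>Since \<open>tri (- n) = tri n + n\<close>, the terms of negative index form the
  one-sided series with \<open>p / z\<close> in place of \<open>z\<close>.\<close>

lemma abs_summable_bilateral:
  fixes p z :: complex
  assumes "norm p < 1" "z \<noteq> 0"
  shows "(\<lambda>k. norm (p ^ tri k * z powi k)) summable_on UNIV"
proof -
  let ?f = "\<lambda>k. norm (p ^ tri k * z powi k)"
  have "(\<lambda>n. norm (p ^ tri (int n) * z ^ n)) summable_on UNIV"
    using summable_theta_terms[OF assms(1)] by (intro norm_summable_imp_summable_on) simp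
  then have 1: "?f summable_on range int"
    by (subst summable_on_reindex) (auto simp: o_def)
  have "tri (- int n) = tri (int n) + n" for n
    using int_tri[of "- int n"] int_tri[of "int n"] by (simp add: algebra_simps)
  then have "p ^ tri (- int n) * z powi (- int n) = p ^ tri (int n) * (p / z) ^ n" for n
    by (simp add: power_add power_int_minus field_simps)
  moreover have "(\<lambda>n. norm (p ^ tri (int n) * (p / z) ^ n)) summable_on UNIV"
    using summable_theta_terms[OF assms(1)] by (intro norm_summable_imp_summable_on) simp
  ultimately have 2: "?f summable_on range (\<lambda>n. - int n)"
    by (subst summable_on_reindex) (auto simp: o_def inj_on_def)
  have "range int \<union> range (\<lambda>n. - int n) = UNIV"
  proof -
    have "k \<in> range int \<union> range (\<lambda>n. - int n)" for k
      by (cases k rule: int_cases2) auto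
    then show ?thesis
      by blast
  qed
  with summable_on_union[OF 1 2] show ?thesis
    by simp
qed

lemma has_sum_theta_series:
  assumes "norm p < 1" "z \<noteq> 0"
  shows "((\<lambda>k. p ^ tri k * z powi k) has_sum theta_series p z) UNIV"
  unfolding theta_series_def
  by (rule has_sum_infsum, rule abs_summable_summable, rule abs_summable_bilateral[OF assms])

lemma qfact_bounds:
  assumes "norm p < 1"
  obtains K where "\<And>n. norm (qfact p n) \<le> K" "\<And>n. norm (inverse (qfact p n)) \<le> K"
proof -
  have "qpoch p p \<noteq> 0"
    by (rule qpoch_nonzero[OF assms assms])
  then have "(\<lambda>n. inverse (qfact p n)) \<longlonglongrightarrow> inverse (qpoch p p)"
    using qfact_LIMSEQ[OF assms] by (intro tendsto_inverse)
  then have "Bseq (qfact p)" "Bseq (\<lambda>n. inverse (qfact p n))"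
    using convergent_imp_Bseq[OF convergentI] qfact_LIMSEQ[OF assms] by blast+
  then obtain K1 K2 where "\<And>n. norm (qfact p n) \<le> K1" "\<And>n. norm (inverse (qfact p n)) \<le> K2"
    unfolding Bseq_def by blast
  then show thesis
    using that[of "max K1 K2"] by (simp add: le_max_iff_disj)
qed

text \<open>All three q-factorials in the quotient tend to \<open>qpoch p p\<close>, which is
  nonzero. Setting the value to 0 for large \<open>\<bar>k\<bar>\<close> leaves the limit unchanged
  and lets the finite sums be read as sums over all integers.\<close>

lemma tendsto_qbinom:
  assumes "norm p < 1"
  shows "(\<lambda>n. if \<bar>k\<bar> \<le> int n then qbinom p (2 * n) (nat (int n + k)) else 0) \<longlonglongrightarrow> inverse (qpoch p p)"
proof -
  have nz: "qpoch p p \<noteq> 0"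
    by (rule qpoch_nonzero[OF assms assms])
  have "filterlim (\<lambda>n. 2 * n) at_top sequentially" "filterlim (\<lambda>n. nat (int n + k)) at_top sequentially"
      "filterlim (\<lambda>n. nat (int n - k)) at_top sequentially"
    by real_asymp+
  note l = this[THEN filterlim_compose[OF qfact_LIMSEQ[OF assms]]]
  have "(\<lambda>n. qfact p (2 * n) / (qfact p (nat (int n + k)) * qfact p (nat (int n - k)))) \<longlonglongrightarrow>
      qpoch p p / (qpoch p p * qpoch p p)"
    using l nz by (intro tendsto_intros) auto
  moreover have "qpoch p p / (qpoch p p * qpoch p p) = inverse (qpoch p p)"
    using nz by (simp add: field_simps)
  moreover have "\<forall>\<^sub>F n in sequentially. qfact p (2 * n) / (qfact p (nat (int n + k)) * qfact p (nat (int n - k)))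
      = (if \<bar>k\<bar> \<le> int n then qbinom p (2 * n) (nat (int n + k)) else 0)"
    using eventually_ge_at_top[of "nat \<bar>k\<bar>"]
  proof eventually_elim
    case (elim n)
    then have "nat (int n + k) \<le> 2 * n" "2 * n - nat (int n + k) = nat (int n - k)" "\<bar>k\<bar> \<le> int n"
      by auto
    then show ?case
      by (simp add: qbinom_def)
  qed
  ultimately show ?thesis
    using Lim_transform_eventually by (simp only:)
qed

text \<open>The limit of the finite triple product, exchanged with the sum by Tannery's theorem. As
  that theorem speaks of series over the naturals, the integers are enumerated by
  \<open>int_decode\<close>.\<close>

theorem jacobi_triple_product:
  assumes p: "norm p < 1" "p \<noteq> 0" and x: "x \<noteq> 0"
  shows "qpoch p p * qtheta x p = theta_series p (- x)"
proof -
  have nz: "qpoch p p \<noteq> 0"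
    using p by (intro qpoch_nonzero)
  let ?t = "\<lambda>k. p ^ tri k * (- x) powi k"
  define b where "b n k = (if \<bar>k\<bar> \<le> int n then qbinom p (2 * n) (nat (int n + k)) else 0)" for n k
  obtain K where K: "\<And>n. norm (qfact p n) \<le> K" "\<And>n. norm (inverse (qfact p n)) \<le> K"
    using qfact_bounds[OF p(1)] by blast
  have K0: "K \<ge> 0"
    using K(1)[of 0] norm_ge_zero order_trans by blast
  \<comment> \<open>A q-factorial times two inverse q-factorials: the bound is uniform in
    \<open>n\<close> and \<open>k\<close>, which yields the majorant \<open>M\<close>.\<close>
  have b: "norm (b n k) \<le> K * (K * K)" for n k
  proof (cases "\<bar>k\<bar> \<le> int n")
    case True
    then have *: "b n k = qfact p (2 * n) * (inverse (qfact p (nat (int n + k))) * inverse (qfact p (2 * n - nat (int n + k))))"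
      by (auto simp: b_def qbinom_def field_simps)
    show ?thesis
      unfolding * norm_mult by (intro mult_mono mult_nonneg_nonneg norm_ge_zero K K0)
  qed (use K0 in \<open>auto simp: b_def\<close>)
  define M where "M k = K * (K * K) * norm (?t (int_decode k))" for k
  have summ: "(\<lambda>k. norm (?t k)) summable_on UNIV"
    using p x by (intro abs_summable_bilateral) auto
  then have "(\<lambda>k. norm (?t (int_decode k))) summable_on UNIV"
    by (subst summable_on_reindex_bij_betw[OF bij_int_decode])
  then have "summable (\<lambda>k. norm (?t (int_decode k)))"
    by (rule summable_on_imp_summable)
  then have M: "summable M"
    unfolding M_def by (rule summable_mult)
  have "eventually (\<lambda>(k, n). norm (b n (int_decode k) * ?t (int_decode k)) \<le> M k) (at_top \<times>\<^sub>F sequentially)"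
  proof (rule always_eventually, safe)
    fix k n
    show "norm (b n (int_decode k) * ?t (int_decode k)) \<le> M k"
      unfolding M_def norm_mult[of "b n (int_decode k)"] by (intro mult_right_mono b norm_ge_zero)
  qed
  moreover have "(\<lambda>n. b n (int_decode k) * ?t (int_decode k)) \<longlonglongrightarrow> inverse (qpoch p p) * ?t (int_decode k)" for k
    unfolding b_def by (intro tendsto_mult tendsto_const tendsto_qbinom p)
  ultimately have lim: "(\<lambda>n. \<Sum>k. b n (int_decode k) * ?t (int_decode k)) \<longlonglongrightarrow>
      (\<Sum>k. inverse (qpoch p p) * ?t (int_decode k))"
    using M tannerys_theorem[of "\<lambda>k n. b n (int_decode k) * ?t (int_decode k)" _ sequentially M] by simp
  have "(\<Sum>k. b n (int_decode k) * ?t (int_decode k)) = (\<Prod>i<n. 1 - x * p ^ i) * (\<Prod>i<n. 1 - p / x * p ^ i)" for n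
  proof -
    have "((\<lambda>k. b n k * ?t k) has_sum (\<Sum>k\<in>{-int n..int n}. b n k * ?t k)) UNIV"
      by (rule has_sum_finite_neutralI) (auto simp: b_def)
    then have "((\<lambda>k. b n (int_decode k) * ?t (int_decode k)) has_sum (\<Sum>k\<in>{-int n..int n}. b n k * ?t k)) UNIV"
      by (subst has_sum_reindex_bij_betw[OF bij_int_decode])
    then have "(\<Sum>k. b n (int_decode k) * ?t (int_decode k)) = (\<Sum>k\<in>{-int n..int n}. b n k * ?t k)"
      by (intro sums_unique[symmetric] has_sum_imp_sums)
    also have "\<dots> = (\<Prod>i<n. 1 - x * p ^ i) * (\<Prod>i<n. 1 - p / x * p ^ i)"
      unfolding finite_triple_product[OF p x] by (intro sum.cong) (auto simp: b_def)
    finally show ?thesis .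
  qed
  moreover have "(\<lambda>n. (\<Prod>i<n. 1 - x * p ^ i) * (\<Prod>i<n. 1 - p / x * p ^ i)) \<longlonglongrightarrow> qtheta x p"
    unfolding qtheta_def by (intro tendsto_mult qpoch_LIMSEQ p)
  ultimately have "(\<Sum>k. inverse (qpoch p p) * ?t (int_decode k)) = qtheta x p"
    using lim by (simp add: LIMSEQ_unique)
  moreover have "(\<Sum>k. inverse (qpoch p p) * ?t (int_decode k)) = inverse (qpoch p p) * theta_series p (- x)"
  proof -
    have "(?t has_sum theta_series p (- x)) UNIV"
      using p x by (intro has_sum_theta_series) auto
    then have "((\<lambda>k. ?t (int_decode k)) has_sum theta_series p (- x)) UNIV"
      by (subst has_sum_reindex_bij_betw[OF bij_int_decode])
    then have "(\<lambda>k. ?t (int_decode k)) sums theta_series p (- x)"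
      by (rule has_sum_imp_sums)
    then show ?thesis
      by (intro sums_unique[symmetric] sums_mult)
  qed
  ultimately show ?thesis
    using nz by (simp add: field_simps)
qed

subsection \<open>The three-term relation\<close>

text \<open>Absolute summability of both families carries over to the family of pairs, so the double
  sum may later be split by the parity of \<open>m + n\<close>.\<close>

lemma has_sum_times:
  fixes f :: "'a \<Rightarrow> complex" and g :: "'b \<Rightarrow> complex"
  assumes "(\<lambda>k. norm (f k)) summable_on UNIV" "(\<lambda>k. norm (g k)) summable_on UNIV"
    and "(f has_sum a) UNIV" "(g has_sum b) UNIV"
  shows "((\<lambda>(m, n). f m * g n) has_sum (a * b)) UNIV"
proof -
  have "((\<lambda>(m, n). f m * g n) has_sum (a * b)) (UNIV \<times> UNIV)"
  proof (rule has_sum_SigmaI[where g = "\<lambda>m. f m * b"])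
    show "((\<lambda>n. case (m, n) of (m, n) \<Rightarrow> f m * g n) has_sum f m * b) UNIV" for m
      using has_sum_cmult_right[OF assms(4)] by simp
    show "((\<lambda>m. f m * b) has_sum a * b) UNIV"
      using has_sum_cmult_left[OF assms(3)] .
    have "(\<lambda>x. norm ((\<lambda>(m, n). f m * g n) x)) summable_on Sigma UNIV (\<lambda>_. UNIV)"
    proof (rule Infinite_Sum.abs_summable_on_Sigma_iff[where f = "\<lambda>(m, n). f m * g n", THEN iffD2], intro conjI ballI)
      show "(\<lambda>n. norm (case (m, n) of (m, n) \<Rightarrow> f m * g n)) summable_on UNIV" for m
        using summable_on_cmult_right[OF assms(2)] by (simp add: norm_mult)
      have "(\<Sum>\<^sub>\<infinity>n. norm (f m * g n)) = norm (f m) * (\<Sum>\<^sub>\<infinity>n. norm (g n))" for m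
        by (simp add: norm_mult infsum_cmult_right')
      then show "(\<lambda>m. norm (\<Sum>\<^sub>\<infinity>n. norm (case (m, n) of (m, n) \<Rightarrow> f m * g n))) summable_on UNIV"
        using summable_on_cmult_left[OF assms(1)] by (simp add: abs_mult)
    qed
    then show "(\<lambda>(m, n). f m * g n) summable_on Sigma UNIV (\<lambda>_. UNIV)"
      by (rule abs_summable_summable)
  qed
  then show ?thesis
    by simp
qed

text \<open>The determinant \<open>D x * B y - B x * D y\<close> of two theta functions:
  \<open>B z\<close> is the sum of \<open>p powi (k * k) * z powi (2 * k)\<close> and
  \<open>D z\<close> that of \<open>p powi (k * k + k) * z powi (2 * k + 1)\<close>.\<close>

definition theta_minor :: "complex \<Rightarrow> complex \<Rightarrow> complex \<Rightarrow> complex" where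
  "theta_minor p x y = x * theta_series (p\<^sup>2) (p\<^sup>2 * x\<^sup>2) * theta_series (p\<^sup>2) (p * y\<^sup>2)
     - theta_series (p\<^sup>2) (p * x\<^sup>2) * (y * theta_series (p\<^sup>2) (p\<^sup>2 * y\<^sup>2))"

lemma theta_term_square:
  assumes "p \<noteq> 0"
  shows "(p\<^sup>2) ^ tri k * (p * z) powi k = p powi (k * k) * z powi k"
    and "(p\<^sup>2) ^ tri k * (p\<^sup>2 * z) powi k = p powi (k * k + k) * (z powi k :: complex)"
proof -
  have "(p\<^sup>2) ^ tri k = p powi (2 * int (tri k))"
    by (simp add: power_int_def nat_mult_distrib power_mult)
  also have "\<dots> = p powi (k * k - k)"
    unfolding int_tri by (simp add: algebra_simps)
  finally have *: "(p\<^sup>2) ^ tri k = p powi (k * k - k)" .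
  have **: "(p\<^sup>2) powi k = p powi (k + k)"
    unfolding power2_eq_square power_int_mult_distrib
    by (rule power_int_add[symmetric]) (simp add: assms)
  show "(p\<^sup>2) ^ tri k * (p * z) powi k = p powi (k * k) * z powi k"
    using assms unfolding * power_int_mult_distrib by (simp flip: power_int_add add: mult.assoc[symmetric])
  show "(p\<^sup>2) ^ tri k * (p\<^sup>2 * z) powi k = p powi (k * k + k) * z powi k"
    using assms unfolding * power_int_mult_distrib ** by (simp flip: power_int_add add: mult.assoc[symmetric] add.commute)
qed

text \<open>
  In the double series of the product, \<open>x\<close> and \<open>y\<close> carry the exponents \<open>m + n\<close> and \<open>m - n\<close>, which
  have the same parity; the even and the odd part each factor.
\<close>

lemma qtheta_product_minor:
  assumes p: "norm p < 1" "p \<noteq> 0" and x: "x \<noteq> 0" and y: "y \<noteq> 0"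
  shows "(qpoch p p)\<^sup>2 * (qtheta (x * y) p * qtheta (x / y) p) = x * theta_minor p x y"
proof -
  let ?t = "\<lambda>x k. p ^ tri k * (- x) powi k"
  define F where "F = (\<lambda>(m, n). ?t (x * y) m * ?t (x / y) n)"
  let ?B = "\<lambda>z. theta_series (p\<^sup>2) (p * z\<^sup>2)" and ?D = "\<lambda>z. theta_series (p\<^sup>2) (p\<^sup>2 * z\<^sup>2)"
  have p2: "norm (p\<^sup>2) < 1"
    using p by (simp add: norm_power power_less_one_iff)
  have F: "(F has_sum theta_series p (- (x * y)) * theta_series p (- (x / y))) UNIV"
    unfolding F_def using p x y
    by (intro has_sum_times abs_summable_bilateral has_sum_theta_series) auto
  have sq: "z\<^sup>2 powi k = (z powi k)\<^sup>2" for z :: complex and k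
    by (simp add: power2_eq_square power_int_mult_distrib)
  have Fval: "F (m, n) = (- 1) powi (m + n) * p powi (int (tri m) + int (tri n)) * (x powi (m + n) * y powi (m - n))" for m n
  proof -
    have "F (m, n) = p powi int (tri m) * p powi int (tri n) * ((- (x * y)) powi m * (- (x / y)) powi n)"
      by (simp add: F_def)
    also have "(- (x * y)) powi m * (- (x / y)) powi n = ((-1) * x * y) powi m * ((-1) * x * inverse y) powi n"
      by (simp add: field_simps)
    also have "\<dots> = (- 1) powi (m + n) * (x powi (m + n) * y powi (m - n))"
      unfolding power_int_mult_distrib using x y
      by (simp add: power_int_add power_int_diff power_int_inverse field_simps)
    finally show ?thesis
      using p by (simp add: power_int_add)
  qed
  have even: "(F has_sum x * (x * ?D x) * ?B y) {(m, n). even (m + n)}"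
  proof -
    have "((\<lambda>(a, b). ((p\<^sup>2) ^ tri a * (p\<^sup>2 * x\<^sup>2) powi a) * ((p\<^sup>2) ^ tri b * (p * y\<^sup>2) powi b)) has_sum (?D x * ?B y)) UNIV"
      using p p2 x y by (intro has_sum_times abs_summable_bilateral has_sum_theta_series) auto
    from has_sum_cmult_right[OF this, of "x\<^sup>2"]
    have "((\<lambda>(a, b). x\<^sup>2 * (((p\<^sup>2) ^ tri a * (p\<^sup>2 * x\<^sup>2) powi a) * ((p\<^sup>2) ^ tri b * (p * y\<^sup>2) powi b)))
        has_sum (x * (x * ?D x) * ?B y)) UNIV"
      by (simp add: case_prod_unfold power2_eq_square mult_ac)
    also have "?this \<longleftrightarrow> ?thesis"
    \<comment> \<open>With \<open>m + n = 2 * (a + 1)\<close> and \<open>m - n = 2 * b\<close> the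
      exponent of \<open>p\<close> becomes \<open>(a * a + a) + b * b\<close>, the one in
      \<open>D x * B y\<close>. The shift of \<open>a\<close> by 1 leaves the factor
      \<open>x * x\<close> in front.\<close>
    proof (rule has_sum_reindex_bij_witness[of _ "\<lambda>(m, n). ((m + n) div 2 - 1, (m - n) div 2)" "\<lambda>(a, b). (a + 1 + b, a + 1 - b)"])
      fix z :: "int \<times> int"
      obtain a b where z: "z = (a, b)"
        by force
      have e: "int (tri (a + 1 + b)) + int (tri (a + 1 - b)) = a * a + a + b * b"
        using int_tri[of "a + 1 + b"] int_tri[of "a + 1 - b"] by (simp add: algebra_simps)
      have s: "(a + 1 + b) + (a + 1 - b) = 2 * (a + 1)" "(a + 1 + b) - (a + 1 - b) = 2 * b"
        by simp_all
      have "F (a + 1 + b, a + 1 - b) = p powi (a * a + a + b * b) * (x powi (2 * (a + 1)) * y powi (2 * b))"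
        unfolding Fval s e by (simp add: power_int_mult)
      also have "\<dots> = x\<^sup>2 * ((p powi (a * a + a) * (x\<^sup>2) powi a) * (p powi (b * b) * (y\<^sup>2) powi b))"
        using p x y by (simp add: power_int_add power_int_mult sq mult_ac)
      finally show "F ((\<lambda>(a, b). (a + 1 + b, a + 1 - b)) z) =
          (\<lambda>(a, b). x\<^sup>2 * (((p\<^sup>2) ^ tri a * (p\<^sup>2 * x\<^sup>2) powi a) * ((p\<^sup>2) ^ tri b * (p * y\<^sup>2) powi b))) z"
        by (simp add: z theta_term_square[OF p(2)])
    next
      fix z :: "int \<times> int" assume "z \<in> {(m, n). even (m + n)}"
      then obtain m n where "z = (m, n)" "even (m + n)"
        by blast
      moreover from this obtain k where "m + n = 2 * k"
        by (elim evenE)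
      moreover from this have "m = 2 * k - n"
        by simp
      ultimately show "(\<lambda>(a, b). (a + 1 + b, a + 1 - b)) ((\<lambda>(m, n). ((m + n) div 2 - 1, (m - n) div 2)) z) = z"
        by simp
    qed auto
    finally show ?thesis .
  qed
  have odd: "(F has_sum - (x * ?B x * (y * ?D y))) {(m, n). odd (m + n)}"
  proof -
    have "((\<lambda>(a, b). ((p\<^sup>2) ^ tri a * (p * x\<^sup>2) powi a) * ((p\<^sup>2) ^ tri b * (p\<^sup>2 * y\<^sup>2) powi b)) has_sum (?B x * ?D y)) UNIV"
      using p p2 x y by (intro has_sum_times abs_summable_bilateral has_sum_theta_series) auto
    from has_sum_cmult_right[OF this, of "- (x * y)"]
    have "((\<lambda>(a, b). - (x * y) * (((p\<^sup>2) ^ tri a * (p * x\<^sup>2) powi a) * ((p\<^sup>2) ^ tri b * (p\<^sup>2 * y\<^sup>2) powi b)))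
        has_sum - (x * ?B x * (y * ?D y))) UNIV"
      by (simp add: case_prod_unfold power2_eq_square mult_ac)
    also have "?this \<longleftrightarrow> ?thesis"
    \<comment> \<open>Here \<open>m + n = 2 * a + 1\<close> and \<open>m - n = 2 * b + 1\<close>, so
      \<open>B\<close> and \<open>D\<close> change places and the odd power of -1 gives the minus
      sign.\<close>
    proof (rule has_sum_reindex_bij_witness[of _ "\<lambda>(m, n). ((m + n) div 2, (m - n) div 2)" "\<lambda>(a, b). (a + b + 1, a - b)"])
      fix z :: "int \<times> int"
      obtain a b where z: "z = (a, b)"
        by force
      have e: "int (tri (a + b + 1)) + int (tri (a - b)) = a * a + (b * b + b)"
        using int_tri[of "a + b + 1"] int_tri[of "a - b"] by (simp add: algebra_simps)
      have s: "(a + b + 1) + (a - b) = 2 * a + 1" "(a + b + 1) - (a - b) = 2 * b + 1"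
        by simp_all
      have "F (a + b + 1, a - b) = - (p powi (a * a + (b * b + b)) * (x powi (2 * a + 1) * y powi (2 * b + 1)))"
        unfolding Fval s e by (simp add: power_int_mult power_int_add)
      also have "\<dots> = - (x * y) * ((p powi (a * a) * (x\<^sup>2) powi a) * (p powi (b * b + b) * (y\<^sup>2) powi b))"
        using p x y by (simp add: power_int_add power_int_mult sq mult_ac)
      finally show "F ((\<lambda>(a, b). (a + b + 1, a - b)) z) =
          (\<lambda>(a, b). - (x * y) * (((p\<^sup>2) ^ tri a * (p * x\<^sup>2) powi a) * ((p\<^sup>2) ^ tri b * (p\<^sup>2 * y\<^sup>2) powi b))) z"
        by (simp add: z theta_term_square[OF p(2)])
    next
      fix z :: "int \<times> int" assume "z \<in> {(m, n). odd (m + n)}"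
      then obtain m n where "z = (m, n)" "odd (m + n)"
        by blast
      moreover from this obtain k where "m + n = 2 * k + 1"
        by (elim oddE)
      moreover from this have "m = 2 * k + 1 - n"
        by simp
      ultimately show "(\<lambda>(a, b). (a + b + 1, a - b)) ((\<lambda>(m, n). ((m + n) div 2, (m - n) div 2)) z) = z"
        by simp presburger
    qed auto
    finally show ?thesis .
  qed
  have "(F has_sum x * (x * ?D x) * ?B y + - (x * ?B x * (y * ?D y))) ({(m, n). even (m + n)} \<union> {(m, n). odd (m + n)})"
    by (rule has_sum_Un_disjoint[OF even odd]) auto
  also have "{(m, n). even (m + n)} \<union> {(m, n). odd (m + n)} = (UNIV :: (int \<times> int) set)"
    by auto
  finally have "theta_series p (- (x * y)) * theta_series p (- (x / y)) = x * theta_minor p x y"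
    using has_sum_unique[OF F] by (simp add: theta_minor_def algebra_simps)
  then show ?thesis
    using p x y by (simp add: power2_eq_square mult_ac flip: jacobi_triple_product)
qed

text \<open>Weierstrass's relation is the Pluecker relation between the minors \<^const>\<open>theta_minor\<close>.\<close>

lemma qtheta_three_term:
  assumes p: "norm p < 1" "p \<noteq> 0" and "x \<noteq> 0" "y \<noteq> 0" "u \<noteq> 0"
  shows "qtheta (x * y) p * qtheta (x / y) p * (qtheta u p)\<^sup>2
    - (qtheta x p)\<^sup>2 * (qtheta (u * y) p * qtheta (u / y) p)
    = u / y * (qtheta y p)\<^sup>2 * (qtheta (x * u) p * qtheta (x / u) p)"
proof -
  define E where "E = (qpoch p p)\<^sup>2"
  have E: "E \<noteq> 0"
    using qpoch_nonzero[of p p] p by (simp add: E_def)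
  have prod: "E * (qtheta (a * b) p * qtheta (a / b) p) = a * theta_minor p a b" if "a \<noteq> 0" "b \<noteq> 0" for a b
    unfolding E_def by (rule qtheta_product_minor[OF p that])
  have square: "E * (qtheta a p)\<^sup>2 = a * theta_minor p a 1" if "a \<noteq> 0" for a
    using prod[of a 1] that by (simp add: power2_eq_square)
  have "y * (E * E * (qtheta (x * y) p * qtheta (x / y) p * (qtheta u p)\<^sup>2
    - (qtheta x p)\<^sup>2 * (qtheta (u * y) p * qtheta (u / y) p))) =
    y * ((E * (qtheta (x * y) p * qtheta (x / y) p)) * (E * (qtheta u p)\<^sup>2)
    - (E * (qtheta x p)\<^sup>2) * (E * (qtheta (u * y) p * qtheta (u / y) p)))"
    by (simp add: algebra_simps)
  also have "\<dots> = y * ((x * theta_minor p x y) * (u * theta_minor p u 1) - (x * theta_minor p x 1) * (u * theta_minor p u y))"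
    by (simp only: prod square assms not_False_eq_True)
  \<comment> \<open>With the minors abbreviated to brackets:
    \<open>[x y] [u 1] - [x 1] [u y] = [y 1] [x u]\<close>.\<close>
  also have "\<dots> = u * (y * theta_minor p y 1) * (x * theta_minor p x u)"
    unfolding theta_minor_def by Groebner_Basis.algebra
  also have "\<dots> = u * (E * (qtheta y p)\<^sup>2) * (E * (qtheta (x * u) p * qtheta (x / u) p))"
    by (simp only: prod square assms not_False_eq_True)
  finally show ?thesis
    using E \<open>y \<noteq> 0\<close> by (simp add: divide_simps) (simp add: mult_ac)
qed

subsection \<open>The cubic modular equation\<close>

text \<open>The three-term relation with \<open>u\<close> the square of \<open>z\<close>: there
  \<open>x / u = 1 / z\<close>, and inversion returns this argument to \<open>z\<close>.\<close>

lemma qtheta_double: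
  assumes "norm p < 1" "p \<noteq> 0" "z \<noteq> 0" "t \<noteq> 0"
  shows "qtheta (z * t) p * qtheta (z / t) p * (qtheta (z\<^sup>2) p)\<^sup>2
    - (qtheta z p)\<^sup>2 * (qtheta (z\<^sup>2 * t) p * qtheta (z\<^sup>2 / t) p)
    = - z / t * (qtheta t p)\<^sup>2 * (qtheta z p * qtheta (z ^ 3) p)"
proof -
  have "qtheta (z / z\<^sup>2) p = - qtheta z p / z"
    using assms qtheta_inverse[of p z] by (simp add: power2_eq_square)
  moreover have "z * z\<^sup>2 = z ^ 3"
    by (simp add: eval_nat_numeral)
  ultimately have "z\<^sup>2 / t * (qtheta t p)\<^sup>2 * (qtheta (z * z\<^sup>2) p * qtheta (z / z\<^sup>2) p) =
      - z / t * (qtheta t p)\<^sup>2 * (qtheta z p * qtheta (z ^ 3) p)"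
    using assms by (simp only:) (simp add: power2_eq_square)
  moreover have "z\<^sup>2 \<noteq> 0"
    using assms by simp
  ultimately show ?thesis
    using qtheta_three_term[OF assms, of "z\<^sup>2"] by simp
qed

text \<open>Doubling with \<open>z = q\<close> and \<open>t = w\<close> is multiplied by
  \<open>h * g\<close>. This completes the products over the cube roots of unity, which then
  collapse to theta products of nome \<open>q ^ 15\<close>.\<close>

lemma rogers_ramanujan_cubic_1:
  assumes q: "norm q < 1" "q \<noteq> 0" and w: "w\<^sup>2 + w + 1 = 0"
  defines "g \<equiv> qtheta (q\<^sup>2) (q ^ 5)" and "h \<equiv> qtheta q (q ^ 5)"
    and "g3 \<equiv> qtheta (q ^ 6) (q ^ 15)" and "h3 \<equiv> qtheta (q ^ 3) (q ^ 15)"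
  shows "h3 * g ^ 3 - h ^ 3 * g3 = - q / w * (qtheta w (q ^ 5))\<^sup>2 * g\<^sup>2 * h\<^sup>2"
proof -
  have p: "norm (q ^ 5) < 1" "q ^ 5 \<noteq> 0" and w0: "w \<noteq> 0"
    using q w by (auto simp: norm_power power_less_one_iff)
  have "qtheta (q ^ 3) (q ^ 5) = qtheta (q ^ 5 / q\<^sup>2) (q ^ 5)"
    using q by (simp add: eval_nat_numeral)
  then have g: "qtheta (q ^ 3) (q ^ 5) = g"
    using qtheta_reflect[of "q ^ 5" "q\<^sup>2"] q by (simp add: g_def)
  have h3: "h * qtheta (q * w) (q ^ 5) * qtheta (q / w) (q ^ 5) = h3"
    using qtheta_cube[OF p(1) w q(2)] by (simp add: h_def h3_def flip: power_mult)
  have g3: "g * qtheta (q\<^sup>2 * w) (q ^ 5) * qtheta (q\<^sup>2 / w) (q ^ 5) = g3"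
    using qtheta_cube[OF p(1) w, of "q\<^sup>2"] q by (simp add: g_def g3_def flip: power_mult)
  have "qtheta (q * w) (q ^ 5) * qtheta (q / w) (q ^ 5) * g\<^sup>2
    - h\<^sup>2 * (qtheta (q\<^sup>2 * w) (q ^ 5) * qtheta (q\<^sup>2 / w) (q ^ 5))
    = - q / w * (qtheta w (q ^ 5))\<^sup>2 * (h * g)" (is "?l = ?r")
    using qtheta_double[OF p q(2) w0] unfolding g by (simp add: g_def h_def)
  then have "h * g * ?l = h * g * ?r"
    by simp
  then show ?thesis
    unfolding h3[symmetric] g3[symmetric]
    by (simp add: algebra_simps power2_eq_square power3_eq_cube)
qed

text \<open>The counterpart with \<open>z = q ^ 3\<close> and \<open>t = q ^ 5\<close>: now
  \<open>g\<close> and \<open>h\<close> are dissected into theta products of nome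
  \<open>q ^ 15\<close>, and multiplying by \<open>h3 * g3\<close> supplies the factors missing from
  them.\<close>

lemma rogers_ramanujan_cubic_2:
  assumes q: "norm q < 1" "q \<noteq> 0"
  defines "g \<equiv> qtheta (q\<^sup>2) (q ^ 5)" and "h \<equiv> qtheta q (q ^ 5)"
    and "g3 \<equiv> qtheta (q ^ 6) (q ^ 15)" and "h3 \<equiv> qtheta (q ^ 3) (q ^ 15)"
  shows "g * g3 ^ 3 + q\<^sup>2 * h * h3 ^ 3 = (qtheta (q ^ 5) (q ^ 15))\<^sup>2 * g3\<^sup>2 * h3\<^sup>2"
proof -
  define \<theta> where "\<theta> = (\<lambda>x. qtheta x (q ^ 15))"
  have p: "norm (q ^ 15) < 1" "q ^ 15 \<noteq> 0" and p5: "norm (q ^ 5) < 1"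
    using q by (auto simp: norm_power power_less_one_iff)
  have reflect: "\<theta> (q ^ (15 - n)) = \<theta> (q ^ n)" if "n \<le> 15" for n
    using qtheta_reflect[of "q ^ 15" "q ^ n"] q that by (simp add: \<theta>_def power_diff)
  \<comment> \<open>The dissection gives the exponents 2, 7 and 12; reflection turns 12 into
    3.\<close>
  have g: "g = \<theta> (q ^ 2) * \<theta> (q ^ 7) * h3"
    using qtheta_dissect3[OF p5, of "q\<^sup>2"] reflect[of 3] q
    by (simp add: g_def h3_def \<theta>_def flip: power_mult power_add)
  have h: "h = \<theta> q * g3 * \<theta> (q ^ 11)"
    using qtheta_dissect3[OF p5, of q] q
    by (simp add: h_def g3_def \<theta>_def flip: power_mult power_add power_Suc)
  have "\<theta> (q ^ 3 * q ^ 5) * \<theta> (q ^ 3 / q ^ 5) * (\<theta> ((q ^ 3)\<^sup>2))\<^sup>2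
    - (\<theta> (q ^ 3))\<^sup>2 * (\<theta> ((q ^ 3)\<^sup>2 * q ^ 5) * \<theta> ((q ^ 3)\<^sup>2 / q ^ 5))
    = - (q ^ 3) / q ^ 5 * (\<theta> (q ^ 5))\<^sup>2 * (\<theta> (q ^ 3) * \<theta> ((q ^ 3) ^ 3))"
    unfolding \<theta>_def using q by (intro qtheta_double p) auto
  moreover have "q ^ 3 * q ^ 5 = q ^ 8" "q ^ 3 / q ^ 5 = 1 / q\<^sup>2" "(q ^ 3)\<^sup>2 = q ^ 6"
      "q ^ 6 * q ^ 5 = q ^ 11" "q ^ 6 / q ^ 5 = q" "- (q ^ 3) / q ^ 5 = - (1 / q\<^sup>2)" "(q ^ 3) ^ 3 = q ^ 9"
    using q by (simp_all add: eval_nat_numeral)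
  moreover have "\<theta> (1 / q\<^sup>2) = - \<theta> (q\<^sup>2) / q\<^sup>2"
    unfolding \<theta>_def using q by (intro qtheta_inverse p) auto
  moreover have "\<theta> (q ^ 8) = \<theta> (q ^ 7)" "\<theta> (q ^ 9) = \<theta> (q ^ 6)"
    using reflect[of 7] reflect[of 6] by simp_all
  ultimately have *: "\<theta> (q ^ 7) * (- \<theta> (q\<^sup>2) / q\<^sup>2) * g3\<^sup>2 - h3\<^sup>2 * (\<theta> (q ^ 11) * \<theta> q)
      = - (1 / q\<^sup>2) * (\<theta> (q ^ 5))\<^sup>2 * (h3 * g3)"
    by (simp only: g3_def h3_def) (simp add: \<theta>_def)
  have "\<theta> (q ^ 7) * \<theta> (q\<^sup>2) * g3\<^sup>2 + q\<^sup>2 * (h3\<^sup>2 * (\<theta> (q ^ 11) * \<theta> q)) = (\<theta> (q ^ 5))\<^sup>2 * (h3 * g3)"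
  proof -
    have "a * b * d + c * e = f * k" if "a * (- b / c) * d - e = - (1 / c) * f * k" "c \<noteq> 0" for a b c d e f k :: complex
    proof -
      have "c * (a * b * d + c * e) = c * (f * k)"
        using that by (simp add: field_simps)
      then show ?thesis
        using that by simp
    qed
    from this[OF *] show ?thesis
      using q by simp
  qed
  then have "h3 * g3 * (\<theta> (q ^ 7) * \<theta> (q\<^sup>2) * g3\<^sup>2 + q\<^sup>2 * (h3\<^sup>2 * (\<theta> (q ^ 11) * \<theta> q)))
      = h3 * g3 * ((\<theta> (q ^ 5))\<^sup>2 * (h3 * g3))"
    by simp
  moreover have "qtheta (q ^ 5) (q ^ 15) = \<theta> (q ^ 5)"
    by (simp add: \<theta>_def)
  ultimately show ?thesis
    unfolding g h by (simp add: algebra_simps power2_eq_square power3_eq_cube)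
qed

text \<open>In the product of the two identities the theta values at the torsion points combine to
  \<open>1 - w\<close>, and \<open>- (1 - w) ^ 2 / w = 3\<close>.\<close>

lemma rogers_ramanujan_cubic:
  assumes q: "norm q < 1" "q \<noteq> 0"
  defines "g \<equiv> qtheta (q\<^sup>2) (q ^ 5)" and "h \<equiv> qtheta q (q ^ 5)"
    and "g3 \<equiv> qtheta (q ^ 6) (q ^ 15)" and "h3 \<equiv> qtheta (q ^ 3) (q ^ 15)"
  shows "(h3 * g ^ 3 - h ^ 3 * g3) * (g * g3 ^ 3 + q\<^sup>2 * h * h3 ^ 3) = 3 * q * (g * h * g3 * h3)\<^sup>2"
proof -
  define w where "w = Complex (- 1 / 2) (sqrt 3 / 2)"
  have w: "w\<^sup>2 + w + 1 = 0"
    by (simp add: w_def complex_eq_iff power2_eq_square)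
  then have w0: "w \<noteq> 0"
    by auto
  have "norm (q ^ 5) < 1" "q ^ 5 \<noteq> 0"
    using q by (auto simp: norm_power power_less_one_iff)
  from qtheta_root_of_unity[OF this(1) w this(2)]
  have \<theta>: "qtheta w (q ^ 5) * qtheta (q ^ 5) (q ^ 15) = 1 - w"
    by (simp flip: power_mult)
  have "(h3 * g ^ 3 - h ^ 3 * g3) * (g * g3 ^ 3 + q\<^sup>2 * h * h3 ^ 3) =
      (- q / w) * (qtheta w (q ^ 5) * qtheta (q ^ 5) (q ^ 15))\<^sup>2 * (g * h * g3 * h3)\<^sup>2"
    using rogers_ramanujan_cubic_1[OF q w] rogers_ramanujan_cubic_2[OF q]
    by (simp add: g_def h_def g3_def h3_def power_mult_distrib)
  also have "(- q / w) * (qtheta w (q ^ 5) * qtheta (q ^ 5) (q ^ 15))\<^sup>2 = 3 * q"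
  proof -
    have "(1 - w)\<^sup>2 = (w\<^sup>2 + w + 1) - 3 * w"
      by (simp add: power2_eq_square algebra_simps)
    then have "(1 - w)\<^sup>2 = - 3 * w"
      using w by simp
    then show ?thesis
      unfolding \<theta> using w0 by simp
  qed
  finally show ?thesis .
qed

section \<open>The continued fraction as a quotient of theta products\<close>

lemma Legendre_5:
  "Legendre (5 * int n + 1) 5 = 1" "Legendre (5 * int n + 2) 5 = - 1"
  "Legendre (5 * int n + 3) 5 = - 1" "Legendre (5 * int n + 4) 5 = 1" "Legendre (5 * int n + 5) 5 = 0"
proof -
  have sq: "(y * y) mod 5 \<in> {0, 1, 4}" for y :: int
  proof -
    have "y mod 5 \<in> {0, 1, 2, 3, 4}"
      by auto
    then show ?thesis
      by (auto simp: mod_mult_eq[of y 5 y, symmetric])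
  qed
  have "QuadRes 5 (5 * int n + 1)"
    unfolding QuadRes_def by (intro exI[of _ 1]) (simp add: unique_euclidean_semiring_class.cong_def)
  then show "Legendre (5 * int n + 1) 5 = 1"
    by (simp add: Legendre_def unique_euclidean_semiring_class.cong_def)
  have "QuadRes 5 (5 * int n + 4)"
    unfolding QuadRes_def by (intro exI[of _ 2]) (simp add: unique_euclidean_semiring_class.cong_def)
  then show "Legendre (5 * int n + 4) 5 = 1"
    by (simp add: Legendre_def unique_euclidean_semiring_class.cong_def)
  have "(y * y) mod 5 \<noteq> 2" for y :: int
    using sq[of y] by auto
  then have "\<not> QuadRes 5 (5 * int n + 2)"
    unfolding QuadRes_def unique_euclidean_semiring_class.cong_def power2_eq_square by simp
  then show "Legendre (5 * int n + 2) 5 = - 1"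
    by (simp add: Legendre_def unique_euclidean_semiring_class.cong_def)
  have "(y * y) mod 5 \<noteq> 3" for y :: int
    using sq[of y] by auto
  then have "\<not> QuadRes 5 (5 * int n + 3)"
    unfolding QuadRes_def unique_euclidean_semiring_class.cong_def power2_eq_square by simp
  then show "Legendre (5 * int n + 3) 5 = - 1"
    by (simp add: Legendre_def unique_euclidean_semiring_class.cong_def)
  show "Legendre (5 * int n + 5) 5 = 0"
    by (simp add: Legendre_def unique_euclidean_semiring_class.cong_def)
qed

lemma Legendre_5_cases: "Legendre k 5 \<in> {-1, 0, 1}"
  by (auto simp: Legendre_def)

text \<open>Once convergence is known, the product is evaluated in blocks of five consecutive
  factors: exponents congruent to 1 and 4 modulo 5 give the numerator, 2 and 3 the
  denominator.\<close>

lemma rr_product: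
  assumes q: "norm q < 1" "q \<noteq> 0"
  shows "(\<Prod>m. (1 - q ^ Suc m) powi Legendre (int (Suc m)) 5) = qtheta q (q ^ 5) / qtheta (q\<^sup>2) (q ^ 5)"
proof (rule LIMSEQ_unique)
  let ?f = "\<lambda>m. (1 - q ^ Suc m) powi Legendre (int (Suc m)) 5"
  have "convergent_prod ?f"
  proof -
    have nz: "norm (q ^ Suc m) \<le> norm q" for m
      using q by (simp add: norm_mult norm_power mult_le_cancel_left1 power_le_one)
    \<comment> \<open>A geometric majorant for all three values of the symbol. For the value -1 the
      deviation from 1 has a denominator of norm at least \<open>1 - norm q\<close>.\<close>
    have bound: "norm (?f m - 1) \<le> norm q ^ Suc m * (1 / (1 - norm q))" for m
    proof -
      have le1: "norm q ^ Suc m \<le> norm q ^ Suc m * (1 / (1 - norm q))"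
        using q by (simp add: field_simps)
      have d: "1 - norm q \<le> norm (1 - q ^ Suc m)"
        using norm_triangle_ineq2[of 1 "q ^ Suc m"] nz[of m] by simp
      then have d0: "1 - q ^ Suc m \<noteq> 0"
        using q by auto
      consider "Legendre (int (Suc m)) 5 = -1" | "Legendre (int (Suc m)) 5 = 0" | "Legendre (int (Suc m)) 5 = 1"
        using Legendre_5_cases[of "int (Suc m)"] by auto
      then show ?thesis
      proof cases
        case 1
        have "?f m - 1 = q ^ Suc m / (1 - q ^ Suc m)"
          unfolding 1 using d0 by (simp add: field_simps)
        also have "norm \<dots> = norm q ^ Suc m * (1 / norm (1 - q ^ Suc m))"
          by (simp add: norm_divide norm_power norm_mult)
        also have "\<dots> \<le> norm q ^ Suc m * (1 / (1 - norm q))"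
          using d q by (intro mult_left_mono divide_left_mono) (auto intro!: mult_pos_pos simp: d0)
        finally show ?thesis .
      next
        case 2
        then show ?thesis
          using q by simp
      next
        case 3
        have "norm (?f m - 1) = norm q ^ Suc m"
          unfolding 3 by (simp add: norm_mult norm_power)
        with le1 show ?thesis
          by simp
      qed
    qed
    have "summable (\<lambda>m. norm q ^ m * (norm q * (1 / (1 - norm q))))"
      using q by (intro summable_mult2 summable_geometric) auto
    then have "summable (\<lambda>m. norm q ^ Suc m * (1 / (1 - norm q)))"
      by (simp add: mult_ac)
    then have "summable (\<lambda>m. norm (?f m - 1))"
      by (rule summable_comparison_test'[where N = 0]) (use bound in \<open>simp del: power_Suc\<close>)
    then show ?thesis
      by (blast intro: abs_convergent_prod_imp_convergent_prod summable_imp_abs_convergent_prod)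
  qed
  from convergent_prod_lessThan_LIMSEQ[OF this]
  have "(\<lambda>N. \<Prod>m<N. ?f m) \<longlonglongrightarrow> prodinf ?f" .
  moreover have "filterlim (\<lambda>N. N * 5) at_top sequentially"
    by (intro mult_nat_right_at_top) simp
  ultimately show "(\<lambda>N. \<Prod>m<N * 5. ?f m) \<longlonglongrightarrow> prodinf ?f"
    by (rule filterlim_compose)
  have p: "norm (q ^ 5) < 1" "q ^ 5 \<noteq> 0"
    using q by (auto simp: norm_power power_less_one_iff)
  have g: "qtheta (q\<^sup>2) (q ^ 5) = qpoch (q\<^sup>2) (q ^ 5) * qpoch (q ^ 3) (q ^ 5)"
    "qtheta q (q ^ 5) = qpoch q (q ^ 5) * qpoch (q ^ 4) (q ^ 5)"
    using q by (simp_all add: qtheta_def eval_nat_numeral)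
  have g0: "qtheta (q\<^sup>2) (q ^ 5) \<noteq> 0"
    using q by (intro qtheta_nonzero) (auto simp: norm_power power_less_one_iff intro!: power_strict_decreasing)
  have "(\<lambda>N. ((\<Prod>n<N. 1 - q * (q ^ 5) ^ n) * (\<Prod>n<N. 1 - q ^ 4 * (q ^ 5) ^ n)) /
        ((\<Prod>n<N. 1 - q\<^sup>2 * (q ^ 5) ^ n) * (\<Prod>n<N. 1 - q ^ 3 * (q ^ 5) ^ n)))
      \<longlonglongrightarrow> qtheta q (q ^ 5) / qtheta (q\<^sup>2) (q ^ 5)"
    using g0 unfolding g by (intro tendsto_divide tendsto_mult qpoch_LIMSEQ p) auto
  also have "(\<lambda>N. ((\<Prod>n<N. 1 - q * (q ^ 5) ^ n) * (\<Prod>n<N. 1 - q ^ 4 * (q ^ 5) ^ n)) /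
        ((\<Prod>n<N. 1 - q\<^sup>2 * (q ^ 5) ^ n) * (\<Prod>n<N. 1 - q ^ 3 * (q ^ 5) ^ n))) = (\<lambda>N. \<Prod>m<N * 5. ?f m)"
  proof
    fix N
    show "((\<Prod>n<N. 1 - q * (q ^ 5) ^ n) * (\<Prod>n<N. 1 - q ^ 4 * (q ^ 5) ^ n)) /
        ((\<Prod>n<N. 1 - q\<^sup>2 * (q ^ 5) ^ n) * (\<Prod>n<N. 1 - q ^ 3 * (q ^ 5) ^ n)) = (\<Prod>m<N * 5. ?f m)"
    proof (induction N)
      case (Suc N)
      \<comment> \<open>The factor of index \<open>m\<close> carries the exponent
        \<open>m + 1\<close>, so \<open>k\<close> from 0 to 4 meets the residues 1, 2, 3, 4,
        0.\<close>
      have f: "?f (N * 5 + k) = (1 - q ^ Suc k * (q ^ 5) ^ N) powi Legendre (5 * int N + int (Suc k)) 5" for k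
      proof -
        have "Suc (N * 5 + k) = Suc k + 5 * N"
          by simp
        then show ?thesis
          by (simp only: power_add power_mult) (simp add: add_ac)
      qed
      have "Suc N * 5 = Suc (Suc (Suc (Suc (Suc (N * 5)))))"
        by simp
      then have "(\<Prod>m<Suc N * 5. ?f m) = (\<Prod>m<N * 5. ?f m) * (?f (N * 5) * ?f (N * 5 + 1) * ?f (N * 5 + 2) * ?f (N * 5 + 3) * ?f (N * 5 + 4))"
        by (simp only: prod.lessThan_Suc mult.assoc) (simp add: eval_nat_numeral)
      also have "?f (N * 5) = 1 - q * (q ^ 5) ^ N"
        using f[of 0] Legendre_5(1)[of N] by simp
      also have "?f (N * 5 + 1) = inverse (1 - q\<^sup>2 * (q ^ 5) ^ N)"
        using f[of 1] Legendre_5(2)[of N] by (simp add: power2_eq_square)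
      also have "?f (N * 5 + 2) = inverse (1 - q ^ 3 * (q ^ 5) ^ N)"
        unfolding f using Legendre_5(3)[of N] by simp
      also have "?f (N * 5 + 3) = 1 - q ^ 4 * (q ^ 5) ^ N"
        unfolding f using Legendre_5(4)[of N] by simp
      also have "?f (N * 5 + 4) = 1"
        unfolding f using Legendre_5(5)[of N] by simp
      finally show ?case
        unfolding Suc.IH[symmetric] prod.lessThan_Suc by (simp add: divide_inverse mult_ac)
    qed simp
  qed
  finally show "(\<lambda>N. \<Prod>m<N * 5. ?f m) \<longlonglongrightarrow> qtheta q (q ^ 5) / qtheta (q\<^sup>2) (q ^ 5)" .
qed

text \<open>Working with the fifth root \<open>s\<close> of q makes every quantity a function of one
  variable: q is \<open>s ^ 5\<close> and the nome is \<open>s ^ 25\<close>.\<close>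

lemma rr_cf_eq:
  assumes "Im \<tau> > 0"
  defines "s \<equiv> exp (2 * of_real pi * \<i> * \<tau> / 5)"
  shows "norm s < 1" "rr_cf \<tau> = s * (qtheta (s ^ 5) (s ^ 25) / qtheta (s ^ 10) (s ^ 25))"
    "qtheta (s ^ 5) (s ^ 25) \<noteq> 0" "qtheta (s ^ 10) (s ^ 25) \<noteq> 0"
proof -
  show s: "norm s < 1"
    using assms by (simp add: s_def norm_exp_eq_Re)
  have s0: "s \<noteq> 0"
    by (simp add: s_def)
  have s5: "s ^ 5 = exp (2 * of_real pi * \<i> * \<tau>)"
    by (simp add: s_def mult_ac flip: exp_of_nat_mult)
  have "norm (s ^ 5) < 1" "s ^ 5 \<noteq> 0"
    using s s0 by (auto simp: norm_power power_less_one_iff)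
  from rr_product[OF this] show "rr_cf \<tau> = s * (qtheta (s ^ 5) (s ^ 25) / qtheta (s ^ 10) (s ^ 25))"
    unfolding rr_cf_def s5[symmetric] s_def[symmetric] by (simp only: power_mult[symmetric]) simp
  show "qtheta (s ^ 5) (s ^ 25) \<noteq> 0" "qtheta (s ^ 10) (s ^ 25) \<noteq> 0"
    using s s0 by (intro qtheta_nonzero; auto simp: norm_power power_less_one_iff intro!: power_strict_decreasing)+
qed

lemma rr_cf_nonzero: "Im \<tau> > 0 \<Longrightarrow> rr_cf \<tau> \<noteq> 0"
  using rr_cf_eq[of \<tau>] by simp

text \<open>Over a common denominator, \<open>v - u ^ 3\<close> and \<open>1 + u * v ^ 3\<close>
  have as numerators, up to a power of \<open>s\<close>, the two factors of the theta identity at q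
  equal to \<open>s ^ 5\<close>.\<close>

theorem rr_cf_cubic_modular_equation:
  assumes "Im \<tau> > 0"
  shows "P3 (rr_cf \<tau>) (rr_cf (3 * \<tau>)) = 0"
proof -
  define s where "s = exp (2 * of_real pi * \<i> * \<tau> / 5)"
  have s3: "exp (2 * of_real pi * \<i> * (3 * \<tau>) / 5) = s ^ 3"
    by (simp add: s_def flip: exp_of_nat_mult)
  define g where "g = qtheta (s ^ 10) (s ^ 25)"
  define h where "h = qtheta (s ^ 5) (s ^ 25)"
  define g3 where "g3 = qtheta (s ^ 30) (s ^ 75)"
  define h3 where "h3 = qtheta (s ^ 15) (s ^ 75)"
  have s: "norm s < 1" "s \<noteq> 0" and u: "rr_cf \<tau> = s * (h / g)" and g: "g \<noteq> 0"
    using rr_cf_eq[OF assms] by (auto simp: s_def g_def h_def)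
  have v: "rr_cf (3 * \<tau>) = s ^ 3 * (h3 / g3)" and g3: "g3 \<noteq> 0"
    using rr_cf_eq[of "3 * \<tau>"] assms unfolding s3 by (auto simp: g3_def h3_def simp flip: power_mult)
  have "norm (s ^ 5) < 1" "s ^ 5 \<noteq> 0"
    using s by (auto simp: norm_power power_less_one_iff)
  from rogers_ramanujan_cubic[OF this]
  have *: "(h3 * g ^ 3 - h ^ 3 * g3) * (g * g3 ^ 3 + s ^ 10 * h * h3 ^ 3) = 3 * s ^ 5 * (g * h * g3 * h3)\<^sup>2"
    by (simp add: g_def h_def g3_def h3_def flip: power_mult)
  have "s ^ 3 * (h3 / g3) - (s * (h / g)) ^ 3 = s ^ 3 * (h3 * g ^ 3 - h ^ 3 * g3) / (g3 * g ^ 3)"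
    using g g3 by (simp add: field_simps)
  moreover have "1 + s * (h / g) * (s ^ 3 * (h3 / g3)) ^ 3 = (g * g3 ^ 3 + s ^ 10 * h * h3 ^ 3) / (g * g3 ^ 3)"
    using g g3 by (simp add: power_mult_distrib power_divide flip: power_mult) (simp add: field_simps, simp add: eval_nat_numeral)
  ultimately have "(rr_cf (3 * \<tau>) - rr_cf \<tau> ^ 3) * (1 + rr_cf \<tau> * rr_cf (3 * \<tau>) ^ 3) =
      s ^ 3 * ((h3 * g ^ 3 - h ^ 3 * g3) * (g * g3 ^ 3 + s ^ 10 * h * h3 ^ 3)) / ((g3 * g ^ 3) * (g * g3 ^ 3))"
    by (simp add: u v)
  also have "\<dots> = 3 * (rr_cf \<tau>)\<^sup>2 * (rr_cf (3 * \<tau>))\<^sup>2"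
    unfolding * u v using g g3 by (simp add: power_mult_distrib power_divide eval_nat_numeral) (simp add: mult_ac)
  finally show ?thesis
    by (simp add: P3_def)
qed

section \<open>Periodicity and complex conjugation of the continued fraction\<close>

lemma rr_cf_add_5:
  "rr_cf (\<tau> + 5 * of_int k) = rr_cf \<tau>"
proof -
  have 1: "exp (2 * of_real pi * \<i> * (\<tau> + 5 * of_int k) / 5) = exp (2 * of_real pi * \<i> * \<tau> / 5)"
  proof -
    have "2 * of_real pi * \<i> * (\<tau> + 5 * of_int k) / 5 = 2 * of_real pi * \<i> * \<tau> / 5 + 2 * of_int k * of_real pi * \<i>"
      by (simp add: field_simps)
    also have "exp \<dots> = exp (2 * of_real pi * \<i> * \<tau> / 5)"
      using exp_integer_2pi[of "of_int k"] by (simp add: exp_add)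
    finally show ?thesis .
  qed
  \<comment> \<open>q is the fifth power of its root, so invariance of the root suffices.\<close>
  have exp5: "exp z = exp (z / 5) ^ 5" for z :: complex
    by (simp flip: exp_of_nat_mult)
  have "exp (2 * of_real pi * \<i> * (\<tau> + 5 * of_int k)) = exp (2 * of_real pi * \<i> * \<tau>)"
    unfolding exp5[of "2 * of_real pi * \<i> * (\<tau> + 5 * of_int k)"] exp5[of "2 * of_real pi * \<i> * \<tau>"] 1 ..
  with 1 show ?thesis
    by (simp add: rr_cf_def)
qed

text \<open>The map sends the fifth root of q to its conjugate, and the theta products have real
  coefficients.\<close>

lemma rr_cf_minus_cnj:
  assumes "Im \<tau> > 0"
  shows "rr_cf (- cnj \<tau>) = cnj (rr_cf \<tau>)"
proof -
  define s where "s = exp (2 * of_real pi * \<i> * \<tau> / 5)"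
  have "exp (2 * of_real pi * \<i> * (- cnj \<tau>) / 5) = cnj s"
    unfolding s_def exp_cnj by simp
  note rr = rr_cf_eq[of "- cnj \<tau>", unfolded this]
  have cnj_qpoch: "cnj (qpoch a p) = qpoch (cnj a) (cnj p)" if "norm p < 1" for a p
  proof (rule LIMSEQ_unique)
    show "(\<lambda>N. cnj (\<Prod>n<N. 1 - a * p ^ n)) \<longlonglongrightarrow> cnj (qpoch a p)"
      by (intro tendsto_cnj qpoch_LIMSEQ that)
    show "(\<lambda>N. cnj (\<Prod>n<N. 1 - a * p ^ n)) \<longlonglongrightarrow> qpoch (cnj a) (cnj p)"
      using qpoch_LIMSEQ[of "cnj p" "cnj a"] that by simp
  qed
  have "norm s < 1"
    using rr_cf_eq[OF assms] by (simp add: s_def)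
  then have "norm (s ^ 25) < 1"
    by (simp add: norm_power power_less_one_iff)
  then show ?thesis
    using rr(2) rr_cf_eq(2)[OF assms] assms by (simp add: qtheta_def cnj_qpoch s_def)
qed

subsection \<open>Norms divisible by the square of a prime above 5\<close>

lemma cnj_of_rat: "cnj (of_rat r) = of_rat r"
  by (cases r) (simp add: of_rat_rat)

lemma quad_field_cnj: "z \<in> quad_field D \<Longrightarrow> cnj z \<in> quad_field D"
proof -
  assume "z \<in> quad_field D"
  then obtain a b where "z = of_rat a + of_rat b * sqrt_neg D"
    by (auto simp: quad_field_def)
  then have "cnj z = of_rat a + of_rat (- b) * sqrt_neg D"
    by (simp add: sqrt_neg_def of_rat_minus cnj_of_rat)
  then show ?thesis
    unfolding quad_field_def by blast
qed

lemma quad_field_divide: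
  assumes "z \<in> quad_field D"
  shows "z / of_int m \<in> quad_field D"
proof -
  from assms obtain a b where "z = of_rat a + of_rat b * sqrt_neg D"
    by (auto simp: quad_field_def)
  then have "z / of_int m = of_rat (a / of_int m) + of_rat (b / of_int m) * sqrt_neg D"
    by (simp add: of_rat_divide add_divide_distrib)
  then show ?thesis
    unfolding quad_field_def by blast
qed

lemma quad_field_trace_norm:
  assumes "z \<in> quad_field D" "D > 0"
  shows "z + cnj z \<in> \<rat>" "z * cnj z \<in> \<rat>"
proof -
  from assms obtain a b where z: "z = of_rat a + of_rat b * sqrt_neg D"
    by (auto simp: quad_field_def)
  have c: "cnj z = of_rat a - of_rat b * sqrt_neg D"
    by (simp add: z sqrt_neg_def cnj_of_rat)
  have s: "sqrt_neg D * sqrt_neg D = - of_int D"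
    using assms by (simp add: sqrt_neg_def complex_eq_iff)
  show "z + cnj z \<in> \<rat>"
    unfolding c by (simp add: z)
  have "z * cnj z = of_rat a * of_rat a - of_rat b * of_rat b * (sqrt_neg D * sqrt_neg D)"
    unfolding c by (simp add: z algebra_simps)
  then show "z * cnj z \<in> \<rat>"
    by (simp add: s)
qed

lemma algebraic_int_quadratic:
  fixes z :: complex
  assumes "z * z - of_int t * z + of_int n = 0"
  shows "algebraic_int z"
proof (rule algebraic_int.intros[of "[:of_int n, - of_int t, 1:]"])
  show "poly [:of_int n, - of_int t, 1:] z = 0"
    using assms by (simp add: algebra_simps)
qed (auto simp: coeff_pCons split: nat.splits)

text \<open>No factorisation of ideals is used. For \<open>x\<close> in \<open>P\<close> the number
  \<open>x * cnj w / 5\<close> is integral, hence so is \<open>y * cnj w * cnj w / 25\<close> for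
  \<open>y\<close> in the square of \<open>P\<close>. With \<open>y = w\<close> the trace says that
  \<open>n * v / 25\<close> is an integer, and 5 does not divide \<open>v\<close> because it divides
  \<open>n\<close> but not \<open>D\<close>.\<close>

lemma prime_square_dvd_norm:
  fixes D v n :: int and P :: "complex set"
  defines "R \<equiv> quad_integers D"
  assumes D: "D > 0" "\<not> 5 dvd D"
    and P: "primeideal P R" "ideal_divides_elem R P 5" "ideal_divides_elem R (P \<cdot>\<^bsub>R\<^esub> P) w"
    and w: "w = (of_int v + sqrt_neg D) / 2" "w \<in> carrier R" and n: "of_int n = w * cnj w"
  shows "25 dvd n" "4 * n = v\<^sup>2 + D"
proof -
  interpret primeideal P R
    by (rule P)
  have R: "x \<otimes>\<^bsub>R\<^esub> y = x * y" "x \<oplus>\<^bsub>R\<^esub> y = x + y" "\<one>\<^bsub>R\<^esub> = 1" for x y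
    by (simp_all add: R_def quad_integers_def)
  have carr: "z \<in> carrier R \<longleftrightarrow> z \<in> quad_field D \<and> algebraic_int z" for z
    by (simp add: R_def quad_integers_def)
  have plus: "x + y \<in> carrier R" and times: "x * y \<in> carrier R" if "x \<in> carrier R" "y \<in> carrier R" for x y
    using a_closed[OF that] m_closed[OF that] by (simp_all add: R)
  have int: "of_int m \<in> carrier R" for m
  proof -
    have "(of_int m :: complex) = of_rat (of_int m) + of_rat 0 * sqrt_neg D"
      by simp
    then have "of_int m \<in> quad_field D"
      unfolding quad_field_def by blast
    then show ?thesis
      by (simp add: carr)
  qed
  have cnj: "cnj z \<in> carrier R" if "z \<in> carrier R" for z
    using that quad_field_cnj by (simp add: carr)
  have trace_int: "z + cnj z \<in> \<int>" and norm_int: "z * cnj z \<in> \<int>" if "z \<in> carrier R" for z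
    using plus[OF that cnj[OF that]] times[OF that cnj[OF that]] quad_field_trace_norm[of z D] that D
    by (auto simp: carr intro: rational_algebraic_int_is_int)
  have P_idl: "ideal P R"
    by (rule ideal_axioms)
  have P_times: "x * y \<in> P" "y * x \<in> P" if "x \<in> P" "y \<in> carrier R" for x y
    using I_l_closed[OF that] I_r_closed[OF that] by (simp_all add: R)
  have P_plus: "x + y \<in> P" if "x \<in> P" "y \<in> P" for x y
    using additive_subgroup.a_closed[OF ideal.axioms(1)[OF P_idl] that] by (simp add: R)

  have "5 \<in> P"
  proof -
    obtain J where "ideal J R" "PIdl\<^bsub>R\<^esub> 5 = P \<cdot>\<^bsub>R\<^esub> J"
      using P(2) unfolding ideal_divides_elem_def by blast
    then show ?thesis
      using ideal_prod_inter[OF P_idl] cgenideal_self[OF int[of 5]] by auto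
  qed
  have w_PP: "w \<in> P \<cdot>\<^bsub>R\<^esub> P"
  proof -
    obtain J where "ideal J R" "PIdl\<^bsub>R\<^esub> w = (P \<cdot>\<^bsub>R\<^esub> P) \<cdot>\<^bsub>R\<^esub> J"
      using P(3) unfolding ideal_divides_elem_def by blast
    then show ?thesis
      using ideal_prod_inter[OF ideal_prod_is_ideal[OF P_idl P_idl]] cgenideal_self[OF w(2)] by auto
  qed
  then have w_P: "w \<in> P"
    using ideal_prod_inter[OF P_idl P_idl] by auto
  \<comment> \<open>By Bezout, an integer prime to 5 lying in \<open>P\<close> would, together with
    5, put 1 into the proper ideal \<open>P\<close>.\<close>
  have P_int: "5 dvd m" if "of_int m \<in> P" for m
  proof (rule ccontr)
    assume "\<not> 5 dvd m"
    then have "Rings.coprime m 5"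
      using prime_imp_coprime[of "5 :: int" m] by (simp add: coprime_commute)
    then obtain a b where ab: "a * m + b * 5 = 1"
      using bezout_int[of m 5] by auto
    have "of_int a * of_int m + of_int b * 5 \<in> P"
      using that \<open>5 \<in> P\<close> int by (intro P_plus P_times)
    then have "of_int (a * m + b * 5) \<in> P"
      by simp
    then have "\<one>\<^bsub>R\<^esub> \<in> P"
      unfolding ab by (simp add: R)
    then show False
      using one_imp_carrier I_notcarr by blast
  qed

  have s: "cnj (sqrt_neg D) = - sqrt_neg D" "sqrt_neg D * sqrt_neg D = - of_int D"
    using D by (simp_all add: sqrt_neg_def complex_eq_iff)
  have "of_int (4 * n) = 4 * (w * cnj w)"
    by (simp flip: n)
  also have "\<dots> = of_int v * of_int v - sqrt_neg D * sqrt_neg D"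
    unfolding w(1) by (simp add: s(1) algebra_simps)
  also have "\<dots> = of_int (v\<^sup>2 + D)"
    by (simp add: s power2_eq_square)
  finally show vn: "4 * n = v\<^sup>2 + D"
    by (simp only: of_int_eq_iff)
  have "of_int n \<in> P"
    unfolding n using w_P cnj[OF w(2)] by (rule P_times)
  then have "5 dvd n"
    by (rule P_int)
  have v5: "\<not> 5 dvd v"
  proof
    assume "5 dvd v"
    then have "5 dvd 4 * n - v\<^sup>2"
      using \<open>5 dvd n\<close> by (simp add: power2_eq_square)
    then show False
      using D vn by simp
  qed

  \<comment> \<open>The trace of \<open>x * cnj w\<close> lies in \<open>P\<close> and its norm in \<open>P\<^sup>2\<close>, hence they are divisible by 5 and 25.\<close>
  have P_cnj_w: "x * cnj w / 5 \<in> carrier R" if "x \<in> P" for x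
  proof -
    define z where "z = x * cnj w"
    have x: "x \<in> carrier R"
      using that by (rule Icarr)
    have z: "z \<in> carrier R"
      unfolding z_def by (intro times x cnj w)
    obtain t where t: "z + cnj z = of_int t"
      using trace_int[OF z] by (auto elim: Ints_cases)
    have "x * cnj w + cnj x * w \<in> P"
      by (intro P_plus P_times that w_P cnj x w)
    then have "of_int t \<in> P"
      by (simp add: z_def flip: t)
    then obtain t' where t': "t = 5 * t'"
      using P_int by (auto elim: dvdE)
    obtain m where m: "x * cnj x = of_int m"
      using norm_int[OF x] by (auto elim: Ints_cases)
    have "of_int m \<in> P"
      unfolding m[symmetric] by (intro P_times that cnj x)
    then obtain m' where m': "m = 5 * m'"
      using P_int by (auto elim: dvdE)
    obtain n' where n': "n = 5 * n'"
      using \<open>5 dvd n\<close> by (auto elim: dvdE)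
    have "z * cnj z = (x * cnj x) * (w * cnj w)"
      by (simp add: z_def mult_ac)
    also have "\<dots> = of_int (25 * (m' * n'))"
      unfolding m n[symmetric] m' n' by simp
    finally have norm: "z * cnj z = 25 * of_int (m' * n')"
      by simp
    \<comment> \<open>So \<open>z / 5\<close> satisfies a monic quadratic equation with trace
      \<open>t'\<close> and norm \<open>m' * n'\<close>.\<close>
    have "z / 5 * (z / 5) - of_int t' * (z / 5) + of_int (m' * n') = (z * z - (z + cnj z) * z + z * cnj z) / 25"
      unfolding norm t t' by (simp add: field_simps)
    also have "\<dots> = 0"
      by (simp add: algebra_simps)
    finally have "algebraic_int (z / 5)"
      by (rule algebraic_int_quadratic)
    moreover have "z / 5 \<in> quad_field D"
      using quad_field_divide[of z D 5] z by (simp add: carr)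
    ultimately show ?thesis
      by (simp add: carr z_def)
  qed
  have "y * cnj w * cnj w / 25 \<in> carrier R" if "y \<in> P \<cdot>\<^bsub>R\<^esub> P" for y
    using that
  proof induction
    case (prod i j)
    have "(i * cnj w / 5) * (j * cnj w / 5) \<in> carrier R"
      by (intro times P_cnj_w prod)
    then show ?case
      by (simp add: R mult_ac)
  next
    case (sum y z)
    from plus[OF sum.IH] show ?case
      by (simp add: R algebra_simps add_divide_distrib)
  qed
  \<comment> \<open>At \<open>y = w\<close> one factor \<open>cnj w\<close> is absorbed into the
    norm \<open>n\<close>.\<close>
  from this[OF w_PP] have "of_int n * cnj w / 25 \<in> carrier R"
    by (simp add: n)
  from trace_int[OF this] obtain k where "of_int n * cnj w / 25 + cnj (of_int n * cnj w / 25) = of_int k"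
    by (auto elim: Ints_cases)
  moreover have "w + cnj w = of_int v"
    unfolding w(1) by (simp add: s field_simps)
  ultimately have "of_int n * of_int v = (25 * of_int k :: complex)"
    by (simp add: field_simps flip: \<open>w + cnj w = of_int v\<close>)
  then have "of_int (n * v) = (of_int (25 * k) :: complex)"
    by simp
  then have "n * v = 25 * k"
    by (simp only: of_int_eq_iff)
  then have "5\<^sup>2 dvd n * v"
    by simp
  moreover have "Rings.coprime (5\<^sup>2) v"
    unfolding coprime_power_left_iff using v5 prime_imp_coprime[of "5 :: int" v] by simp
  ultimately have "5\<^sup>2 dvd n"
    using coprime_dvd_mult_left_iff by blast
  then show "25 dvd n"
    by simp
qed

lemma is_w_norm_dvd:
  assumes "is_w D w" "D > 0" "\<not> 5 dvd D"
  obtains v where "w = (of_int v + sqrt_neg D) / 2" "100 dvd v\<^sup>2 + D"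
proof -
  obtain v n P where "primeideal P (quad_integers D)" "ideal_divides_elem (quad_integers D) P 5"
      "ideal_divides_elem (quad_integers D) (P \<cdot>\<^bsub>quad_integers D\<^esub> P) w"
      "w = (of_int v + sqrt_neg D) / 2" "w \<in> carrier (quad_integers D)" "of_int n = w * cnj w"
    using assms(1) unfolding is_w_def by blast
  moreover from prime_square_dvd_norm[OF assms(2,3) this] have "100 dvd v\<^sup>2 + D"
    using mult_dvd_mono[of 4 4 25 n] by simp
  ultimately show thesis
    using that by blast
qed

text \<open>100 divides \<open>(v' - 3 * v) * (v' + 3 * v)\<close>. The factors differ by
  \<open>6 * v\<close>: hence both are even, and 5 divides at most one of them, which must then take
  the whole factor 25.\<close>

lemma sqrt_congruence:
  fixes v v' d :: int
  assumes "100 dvd v\<^sup>2 + d" "100 dvd v'\<^sup>2 + 9 * d" "\<not> 5 dvd d"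
  obtains k where "v' = 3 * v + 50 * k" | k where "v' = - (3 * v) + 50 * k"
proof -
  have v5: "\<not> 5 dvd v"
  proof
    assume "5 dvd v"
    moreover have "5 dvd v\<^sup>2 + d"
      using assms(1) by (rule dvd_trans[rotated]) simp
    ultimately have "5 dvd (v\<^sup>2 + d) - v\<^sup>2"
      by (intro dvd_diff) (auto simp: power2_eq_square)
    then show False
      using assms(3) by simp
  qed
  have "100 dvd (v'\<^sup>2 + 9 * d) - 9 * (v\<^sup>2 + d)"
    using assms by (intro dvd_diff dvd_mult)
  also have "(v'\<^sup>2 + 9 * d) - 9 * (v\<^sup>2 + d) = (v' - 3 * v) * (v' + 3 * v)"
    by (simp add: power2_eq_square algebra_simps)
  finally have *: "100 dvd (v' - 3 * v) * (v' + 3 * v)" .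
  have "2 dvd (v' - 3 * v) * (v' + 3 * v)"
    using * by (rule dvd_trans[rotated]) simp
  then have e: "2 dvd v' - 3 * v" "2 dvd v' + 3 * v"
    by auto
  have 25: "5\<^sup>2 dvd (v' - 3 * v) * (v' + 3 * v)"
    using * by (rule dvd_trans[rotated]) simp
  have cop: "Rings.coprime (2 :: int) (5\<^sup>2)"
    by simp
  show thesis
  proof (cases "5 dvd v' - 3 * v")
    case True
    have "\<not> 5 dvd v' + 3 * v"
    proof
      assume "5 dvd v' + 3 * v"
      then have "5 dvd (v' + 3 * v) - (v' - 3 * v)"
        using True by (rule dvd_diff)
      then have "5 dvd 6 * v"
        by simp
      then show False
        using v5 by presburger
    qed
    then have "Rings.coprime (5\<^sup>2) (v' + 3 * v)"
      unfolding coprime_power_left_iff using prime_imp_coprime[of "5 :: int" "v' + 3 * v"] by simp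
    then have "5\<^sup>2 dvd v' - 3 * v"
      using 25 coprime_dvd_mult_left_iff by blast
    with e(1) have "2 * 5\<^sup>2 dvd v' - 3 * v"
      using cop by (intro divides_mult)
    then obtain k where "v' - 3 * v = 50 * k"
      by (auto elim: dvdE)
    then show thesis
      using that(1)[of k] by simp
  next
    case False
    then have "Rings.coprime (5\<^sup>2) (v' - 3 * v)"
      unfolding coprime_power_left_iff using prime_imp_coprime[of "5 :: int" "v' - 3 * v"] by simp
    then have "5\<^sup>2 dvd v' + 3 * v"
      using 25 coprime_dvd_mult_right_iff by blast
    with e(2) have "2 * 5\<^sup>2 dvd v' + 3 * v"
      using cop by (intro divides_mult)
    then obtain k where "v' + 3 * v = 50 * k"
      by (auto elim: dvdE)
    then show thesis
      using that(2)[of k] by simp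
  qed
qed



subsection \<open>Minimal polynomials and the resultant\<close>

interpretation of_rat_poly: map_poly_comm_ring_hom "of_rat :: rat \<Rightarrow> complex" ..

text \<open>A polynomial of least degree, made monic, is a candidate for \<open>THE\<close>. It is
  the only one, since the difference of two candidates would be a nonzero polynomial of smaller
  degree with root \<open>z\<close>.\<close>

lemma min_poly_rat_properties:
  assumes "algebraic z"
  shows "lead_coeff (min_poly_rat z) = 1" "poly (map_poly of_rat (min_poly_rat z)) z = 0"
    and "\<And>q. q \<noteq> 0 \<Longrightarrow> poly (map_poly of_rat q) z = 0 \<Longrightarrow> degree (min_poly_rat z) \<le> degree q"
proof -
  let ?Q = "\<lambda>p. p \<noteq> 0 \<and> poly (map_poly of_rat p) z = 0"
  let ?M = "\<lambda>p. lead_coeff p = 1 \<and> poly (map_poly of_rat p) z = 0 \<and>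
    (\<forall>q. ?Q q \<longrightarrow> degree p \<le> degree q)"
  obtain p0 :: "int poly" where "p0 \<noteq> 0" "poly (map_poly of_int p0) z = 0"
    using assms by (rule algebraicE')
  then have "?Q (map_poly of_int p0)"
    by (simp add: map_poly_map_poly o_def)
  from ex_has_least_nat[of ?Q, OF this, of degree]
  obtain p where p: "?Q p" "\<forall>q. ?Q q \<longrightarrow> degree p \<le> degree q"
    by blast
  let ?p = "smult (inverse (lead_coeff p)) p"
  have M: "?M ?p"
    using p by (auto simp: of_rat_hom.map_poly_hom_smult)
  have "\<exists>!p. ?M p"
  proof (rule ex1I[of ?M ?p, OF M])
    fix q assume q: "?M q"
    have deg: "degree q = degree ?p"
    proof (rule antisym)
      have "degree q \<le> degree p"
        using q p(1) by blast
      then show "degree q \<le> degree ?p"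
        using p(1) by simp
      have "q \<noteq> 0"
        using q by auto
      then show "degree ?p \<le> degree q"
        using q M by blast
    qed
    show "q = ?p"
    proof (rule ccontr)
      assume "q \<noteq> ?p"
      then have ne: "q - ?p \<noteq> 0"
        by simp
      moreover have "poly (map_poly of_rat (q - ?p)) z = 0"
        using q M by (simp add: of_rat_poly.hom_minus)
      ultimately have le: "degree q \<le> degree (q - ?p)"
        using q by blast
      have "coeff (q - ?p) (degree q) = 0"
        using q M deg by simp
      moreover have "degree (q - ?p) \<le> degree q"
        using degree_diff_le[of q "degree q" ?p] deg by simp
      ultimately have "lead_coeff (q - ?p) = 0"
        using le by simp
      then show False
        using ne leading_coeff_0_iff by blast
    qed
  qed
  note the = theI'[OF this]
  have eq: "min_poly_rat z = (THE p. ?M p)"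
    using assms by (simp add: min_poly_rat_def)
  have "?M (min_poly_rat z)"
    unfolding eq by (rule the)
  then show "lead_coeff (min_poly_rat z) = 1" "poly (map_poly of_rat (min_poly_rat z)) z = 0"
    and "\<And>q. q \<noteq> 0 \<Longrightarrow> poly (map_poly of_rat q) z = 0 \<Longrightarrow> degree (min_poly_rat z) \<le> degree q"
    by auto
qed


text \<open>For transcendental \<open>z\<close> the default value 0 vanishes at \<open>z\<close> as
  well.\<close>

lemma min_poly_rat_root: "poly (map_poly of_rat (min_poly_rat z)) z = 0"
  using min_poly_rat_properties(2)[of z] by (cases "algebraic z") (simp_all add: min_poly_rat_def)

text \<open>The remainder of \<open>p\<close> again has root \<open>z\<close>, but smaller degree
  than the minimal polynomial.\<close>

lemma min_poly_rat_dvd: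
  assumes "poly (map_poly of_rat p) z = 0"
  shows "min_poly_rat z dvd p"
proof (cases "p = 0")
  case False
  have "algebraic z"
    using False assms by (intro algebraicI'[of "map_poly of_rat p"]) (auto simp: coeff_map_poly)
  note m = min_poly_rat_properties[OF this]
  have m0: "min_poly_rat z \<noteq> 0"
    using m(1) by auto
  have "poly (map_poly of_rat (p mod min_poly_rat z)) z = 0"
  proof -
    have "map_poly of_rat p = map_poly of_rat (p div min_poly_rat z) * map_poly of_rat (min_poly_rat z) +
        (map_poly of_rat (p mod min_poly_rat z) :: complex poly)"
      unfolding of_rat_poly.hom_mult[symmetric] of_rat_poly.hom_add[symmetric] by simp
    then show ?thesis
      using assms m(2) by simp
  qed
  then have "p mod min_poly_rat z = 0"
    using m(3)[of "p mod min_poly_rat z"] degree_mod_less[OF m0, of p] by linarith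
  then show ?thesis
    by (simp add: mod_eq_0_iff_dvd)
qed simp

lemma poly_map_poly_of_rat_cnj:
  "poly (map_poly of_rat p) (cnj z) = cnj (poly (map_poly of_rat p) z)"
  by (simp add: poly_altdef coeff_map_poly cnj_of_rat)

section \<open>Specialising the resultant\<close>

lemma P3_poly: "P3 [:0, 1:] [:x:] = [:x, x ^ 4, - (3 * x\<^sup>2), - 1, - (x ^ 3):]"
  for x :: "'a :: idom"
  unfolding P3_def one_pCons numeral_poly
  by (simp add: power2_eq_square power3_eq_cube power4_eq_xxxx mult.assoc mult.left_commute del: pCons_one)

lemma degree_P3_poly: "x \<noteq> 0 \<Longrightarrow> degree (P3 [:0, 1:] [:x:]) = 4" for x :: "'a :: idom"
  unfolding P3_poly by simp

text \<open>Evaluation at \<open>x\<close> commutes with the resultant as long as no degree drops.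
  The leading coefficient of the first polynomial becomes \<open>- (x ^ 3)\<close>, so
  \<open>x \<noteq> 0\<close> ensures this. The specialised polynomials share the root
  \<open>y\<close>, hence their resultant is 0.\<close>

lemma res_P3_root:
  fixes x y :: complex
  assumes "poly (map_poly of_rat p) y = 0" "P3 y x = 0" "x \<noteq> 0"
  shows "poly (map_poly of_rat (res_P3 p)) x = 0"
proof -
  define ev :: "rat poly \<Rightarrow> complex" where "ev c = poly (map_poly of_rat c) x" for c
  interpret ev: comm_ring_hom ev
    by unfold_locales (simp_all add: ev_def of_rat_poly.hom_add of_rat_poly.hom_mult)
  let ?P = "P3 [:0, 1:] [:x:]" and ?p = "map_poly of_rat p :: complex poly"
  have "ev [:0, 1:] = x"
    by (simp add: ev_def map_poly_pCons)
  then have ev_P3: "map_poly ev (P3 [:0, 1:] [:[:0, 1:]:]) = ?P"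
    unfolding P3_poly by (simp add: map_poly_pCons ev.hom_power ev.hom_mult ev.hom_uminus ev.hom_numeral)
  have ev_p: "map_poly ev (map_poly (\<lambda>c. [:c:]) p) = ?p"
  proof -
    have "ev [:c:] = of_rat c" for c
      by (cases "c = 0") (simp_all add: ev_def map_poly_pCons)
    then show ?thesis
      by (simp add: map_poly_map_poly o_def)
  qed
  have "ev (res_P3 p) = resultant ?P ?p"
    unfolding res_P3_def ev_P3[symmetric] ev_p[symmetric]
  proof (rule ev.resultant_map_poly[symmetric])
    show "degree (map_poly ev (P3 [:0, 1:] [:[:0, 1:]:])) = degree (P3 [:0, 1:] [:[:0, 1:]:] :: rat poly poly)"
      unfolding ev_P3 using assms(3) by (simp only: degree_P3_poly pCons_eq_0_iff one_neq_zero simp_thms)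
    show "degree (map_poly ev (map_poly (\<lambda>c. [:c:]) p)) = degree (map_poly (\<lambda>c. [:c:]) p)"
      unfolding ev_p by (simp add: degree_map_poly)
  qed
  also have "resultant ?P ?p = 0"
  proof -
    have "poly ?P y = P3 y x"
      unfolding P3_poly by (simp add: P3_def algebra_simps eval_nat_numeral)
    then have "[:- y, 1:] dvd ?P" "[:- y, 1:] dvd ?p"
      using assms by (simp_all add: poly_eq_0_iff_dvd)
    then have "[:- y, 1:] dvd gcd ?P ?p"
      by (rule gcd_greatest)
    \<comment> \<open>\<open>?P\<close> is nonzero, its third coefficient being -1.\<close>
    moreover have "gcd ?P ?p \<noteq> 0"
      unfolding P3_poly by simp
    ultimately have "degree (gcd ?P ?p) \<noteq> 0"
      using dvd_imp_degree_le[of "[:- y, 1:]" "gcd ?P ?p"] by simp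
    then show ?thesis
      by (simp add: resultant_0_gcd)
  qed
  finally show ?thesis
    by (simp add: ev_def)
qed

theorem theorem5p1:
  fixes d :: int and p_d p_9d :: "rat poly"
  assumes "negative_discriminant (- d)"
    and "[- d = 1] (mod 5) \<or> [- d = - 1] (mod 5)"
    and "is_p d p_d"
    and "is_p (9 * d) p_9d"
  shows "p_9d dvd res_P3 p_d"
proof -
  have d: "d > 0"
    using assms(1) by (simp add: negative_discriminant_def)
  have d5: "\<not> 5 dvd d"
  proof
    assume "5 dvd d"
    then have "(- d) mod 5 = 0"
      by simp
    then show False
      using assms(2) by (simp add: unique_euclidean_semiring_class.cong_def)
  qed
  then have d5': "\<not> 5 dvd 9 * d"
    using prime_dvd_mult_iff[of "5 :: int" 9 d] by simp
  obtain w where w: "is_w d w" and p_d: "p_d = min_poly_rat (rr_cf (w / 5))"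
    using assms(3) unfolding is_p_def by blast
  obtain w' where w': "is_w (9 * d) w'" and p_9d: "p_9d = min_poly_rat (rr_cf (w' / 5))"
    using assms(4) unfolding is_p_def by blast
  obtain v where v: "w = (of_int v + sqrt_neg d) / 2" "100 dvd v\<^sup>2 + d"
    using is_w_norm_dvd[OF w d d5] .
  obtain v' where v': "w' = (of_int v' + sqrt_neg (9 * d)) / 2" "100 dvd v'\<^sup>2 + 9 * d"
    using is_w_norm_dvd[OF w' _ d5'] d by auto
  have sqrt: "sqrt_neg (9 * d) = 3 * sqrt_neg d"
    by (simp add: sqrt_neg_def real_sqrt_mult)
  define \<tau> where "\<tau> = w / 5"
  have \<tau>: "Im \<tau> > 0" "Im (3 * \<tau>) > 0"
    using d by (simp_all add: \<tau>_def v sqrt_neg_def)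
  have modeq: "P3 (rr_cf \<tau>) (rr_cf (3 * \<tau>)) = 0"
    by (rule rr_cf_cubic_modular_equation[OF \<tau>(1)])
  have root: "poly (map_poly of_rat p_d) (rr_cf \<tau>) = 0"
    unfolding p_d \<tau>_def by (rule min_poly_rat_root)
  have "poly (map_poly of_rat (res_P3 p_d)) (rr_cf (w' / 5)) = 0"
    \<comment> \<open>Changing \<open>v'\<close> by 50 moves \<open>w' / 5\<close> by 5, a period of
      the continued fraction.\<close>
    using sqrt_congruence[OF v(2) v'(2) d5]
  proof cases
    case (1 k)
    have "w' / 5 = 3 * \<tau> + 5 * of_int k"
      unfolding v(1) v'(1) sqrt \<tau>_def 1 by (simp add: field_simps)
    then have "rr_cf (w' / 5) = rr_cf (3 * \<tau>)"
      by (simp only: rr_cf_add_5)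
    then show ?thesis
      using res_P3_root[OF root modeq rr_cf_nonzero[OF \<tau>(2)]] by simp
  next
    \<comment> \<open>The opposite sign reflects \<open>3 * \<tau>\<close> in the imaginary axis,
      which conjugates the value; a polynomial with rational coefficients vanishes at the conjugate
      as well.\<close>
    case (2 k)
    have "w' / 5 = - cnj (3 * \<tau>) + 5 * of_int k"
      unfolding v(1) v'(1) sqrt \<tau>_def 2 by (simp add: sqrt_neg_def field_simps)
    then have "rr_cf (w' / 5) = cnj (rr_cf (3 * \<tau>))"
      by (simp only: rr_cf_add_5 rr_cf_minus_cnj[OF \<tau>(2)])
    then show ?thesis
      using res_P3_root[OF root modeq rr_cf_nonzero[OF \<tau>(2)]] by (simp add: poly_map_poly_of_rat_cnj)
  qed
  then show ?thesis
    unfolding p_9d by (rule min_poly_rat_dvd)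
qed

end
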